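(* Assume that the noise terms $\xi_i$ are subgaussian with parameter $\sigma>0$, i.e. $\mathbb E[e^{u\xi_i}]\le e^{u^2\sigma^2/2}$ for all $u\in\mathbb R$. Then there exist positive constants $C_1,C_2,C_3$, which depend on $d$ and $\sigma$ only, such that for every integer $n\ge 2$ for which $r=\left\lfloor\left(\frac{n}{\ln n}\right)^{\frac{d-1}{d+1}}\right\rfloor$ satisfies $r\ge d+1$, the estimator $\hat P_n^{(r)}$ with this value of $r$ satisfies $$\sup_{C\in\mathcal C_d}\mathbb P_C\Big[n\Big(|\hat P_n^{(r)}\triangle C|-\left(\frac{C_3\ln n}{n}\right)^{2/(d+1)}\Big)\geq x\Big] \leq C_1e^{-C_2x},\qquad \forall x>0.$$
   Context: Let $d\ge 2$ be an integer. One observes $n$ i.i.d. pairs $(X_i,Y_i)$, $i=1,\dots,n$, with $X_i$ uniformly distributed on $[0,1]^d$ and $Y_i=I(X_i\in G)+\xi_i$, where $G\subseteq[0,1]^d$ is unknown, $I(\cdot\in G)$ is the indicator function of $G$, and the errors $\xi_1,\dots,\xi_n$ are i.i.d. real random variables independent of $(X_1,\dots,X_n)$. $\mathbb P_G$ denotes the probability measure associated with the distribution of the $n$ pairs. $|\cdot|$ is Lebesgue measure on $\mathbb R^d$, $\triangle$ is symmetric difference, and $\lfloor x\rfloor$ is the greatest integer less than or equal to $x$. All convex sets considered are compact with nonempty interior. $\mathcal C_d$ is the class of all (compact) convex sets included in $[0,1]^d$. For $r\ge d+1$, $\mathcal P_r^{(n)}$ is the (finite) class of all convex polytopes in $[0,1]^d$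 with at most $r$ vertices whose vertices have coordinates that are integer multiples of $1/n$. Put $\mathcal A(P)=\sum_{i=1}^n(1-2Y_i)I(X_i\in P)$. The estimator $\hat P_n^{(r)}$ is any (measurable) choice of an element of $\operatorname{argmin}_{P\in\mathcal P_r^{(n)}}\mathcal A(P)$. *)

theory Defs
  imports "HOL-Probability.Probability"
begin

definition convex_bodies :: "(real ^ 'd) set set" where
  "convex_bodies = {C. compact C \<and> convex C \<and> interior C \<noteq> {} \<and> C \<subseteq> cbox 0 1}"

text \<open>The vertices of a polytope are its extreme points; a polytope has finitely many of them.\<close>

definition grid_polytopes :: "nat \<Rightarrow> nat \<Rightarrow> (real ^ 'd) set set" where
  "grid_polytopes r n = {P. polytope P \<and> interior P \<noteq> {} \<and> P \<subseteq> cbox 0 1 \<and>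
     card {v. v extreme_point_of P} \<le> r \<and>
     (\<forall>v. v extreme_point_of P \<longrightarrow> (\<forall>i. \<exists>k::int. v $ i = real_of_int k / real n))}"

text \<open>The Bochner integral of a non-integrable function is 0, hence the explicit integrability.\<close>

definition subgaussian :: "real \<Rightarrow> real measure \<Rightarrow> bool" where
  "subgaussian \<sigma> N \<longleftrightarrow>
     (\<forall>u::real. integrable N (\<lambda>z. exp (u * z)) \<and>
        (LINT z|N. exp (u * z)) \<le> exp (u\<^sup>2 * \<sigma>\<^sup>2 / 2))"

text \<open>
  A sample is a function on \<open>{..<n}\<close> with values \<open>(X\<^sub>i, Y\<^sub>i)\<close>.  The law of the sample is the image of
  the joint law of the design points (i.i.d. uniform on the unit cube) and, independently
  of these, the errors (i.i.d. with law \<open>N\<close>).  The lemma \<open>distr_sample\<close> below shows that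
  every probability space carrying such variables
  (independence of the two vectors being the factorisation of their joint law) leads to this measure.
\<close>

definition sample_space :: "nat \<Rightarrow> (nat \<Rightarrow> (real ^ 'd) \<times> real) measure" where
  "sample_space n = (\<Pi>\<^sub>M i\<in>{..<n}. borel)"

definition sample_law ::
    "real measure \<Rightarrow> nat \<Rightarrow> (real ^ 'd) set \<Rightarrow> (nat \<Rightarrow> (real ^ 'd) \<times> real) measure" where
  "sample_law N n G =
     distr ((\<Pi>\<^sub>M i\<in>{..<n}. uniform_measure lborel (cbox 0 1)) \<Otimes>\<^sub>M (\<Pi>\<^sub>M i\<in>{..<n}. N))
       (sample_space n)
       (\<lambda>(X, \<xi>). \<lambda>i\<in>{..<n}. (X i, indicator G (X i) + \<xi> i))"

definition contrast :: "nat \<Rightarrow> (nat \<Rightarrow> (real ^ 'd) \<times> real) \<Rightarrow> (real ^ 'd) set \<Rightarrow> real" where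
  "contrast n \<omega> P = (\<Sum>i<n. (1 - 2 * snd (\<omega> i)) * indicator P (fst (\<omega> i)))"

text \<open>
  Measurability with respect to the discrete \<open>\<sigma>\<close>-algebra on the finite class of candidates.
\<close>

definition is_estimator ::
    "nat \<Rightarrow> nat \<Rightarrow> ((nat \<Rightarrow> (real ^ 'd) \<times> real) \<Rightarrow> (real ^ 'd) set) \<Rightarrow> bool" where
  "is_estimator r n Phat \<longleftrightarrow>
     Phat \<in> measurable (sample_space n) (count_space (grid_polytopes r n)) \<and>
     (\<forall>\<omega>\<in>space (sample_space n).
        is_arg_min (contrast n \<omega>) (\<lambda>P. P \<in> grid_polytopes r n) (Phat \<omega>))"

definition num_vertices :: "nat \<Rightarrow> nat \<Rightarrow> nat" where
  "num_vertices d n = nat \<lfloor>(real n / ln (real n)) powr ((real d - 1) / (real d + 1))\<rfloor>"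

lemma (in prob_space) distr_sample:
  fixes X :: "nat \<Rightarrow> 'a \<Rightarrow> real ^ 'd" and \<xi> :: "nat \<Rightarrow> 'a \<Rightarrow> real"
  assumes n: "0 < n" and G: "G \<in> sets borel"
    and X: "indep_vars (\<lambda>_. borel) X {..<n}"
      "\<And>i. i < n \<Longrightarrow> distr M borel (X i) = uniform_measure lborel (cbox 0 1)"
    and \<xi>: "indep_vars (\<lambda>_. borel) \<xi> {..<n}" "\<And>i. i < n \<Longrightarrow> distr M borel (\<xi> i) = N"
    and indep: "distr M ((\<Pi>\<^sub>M i\<in>{..<n}. borel) \<Otimes>\<^sub>M (\<Pi>\<^sub>M i\<in>{..<n}. borel))
        (\<lambda>\<omega>. ((\<lambda>i\<in>{..<n}. X i \<omega>), \<lambda>i\<in>{..<n}. \<xi> i \<omega>)) =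
      distr M (\<Pi>\<^sub>M i\<in>{..<n}. borel) (\<lambda>\<omega>. \<lambda>i\<in>{..<n}. X i \<omega>) \<Otimes>\<^sub>M
      distr M (\<Pi>\<^sub>M i\<in>{..<n}. borel) (\<lambda>\<omega>. \<lambda>i\<in>{..<n}. \<xi> i \<omega>)"
  shows "distr M (sample_space n)
           (\<lambda>\<omega>. \<lambda>i\<in>{..<n}. (X i \<omega>, indicator G (X i \<omega>) + \<xi> i \<omega>)) = sample_law N n G"
proof -
  let ?B = "\<Pi>\<^sub>M i\<in>{..<n}. (borel :: (real ^ 'd) measure)"
  let ?R = "\<Pi>\<^sub>M i\<in>{..<n}. (borel :: real measure)"
  let ?X = "\<lambda>\<omega>. \<lambda>i\<in>{..<n}. X i \<omega>" and ?\<xi> = "\<lambda>\<omega>. \<lambda>i\<in>{..<n}. \<xi> i \<omega>"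
  let ?f = "\<lambda>(x::nat \<Rightarrow> real ^ 'd, z::nat \<Rightarrow> real). \<lambda>i\<in>{..<n}. (x i, indicator G (x i) + z i)"
  have ne: "{..<n} \<noteq> {}" using n by auto
  have rvX: "random_variable borel (X i)" if "i \<in> {..<n}" for i
    using X(1) that by (auto simp: indep_vars_def2)
  have rv\<xi>: "random_variable borel (\<xi> i)" if "i \<in> {..<n}" for i
    using \<xi>(1) that by (auto simp: indep_vars_def2)
  have dX: "distr M ?B ?X = (\<Pi>\<^sub>M i\<in>{..<n}. uniform_measure lborel (cbox 0 1))"
    using iffD1[OF indep_vars_iff_distr_eq_PiM'[OF ne rvX] X(1)] X(2)
    by (auto intro!: PiM_cong)
  have d\<xi>: "distr M ?R ?\<xi> = (\<Pi>\<^sub>M i\<in>{..<n}. N)"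
    using iffD1[OF indep_vars_iff_distr_eq_PiM'[OF ne rv\<xi>] \<xi>(1)] \<xi>(2)
    by (auto intro!: PiM_cong)
  have G': "indicator G \<in> borel_measurable (borel :: (real ^ 'd) measure)"
    using G by simp
  note [measurable] = G G'
  have f: "?f \<in> measurable (?B \<Otimes>\<^sub>M ?R) (sample_space n)"
  proof -
    have a: "(\<lambda>p. \<lambda>i\<in>{..<n}. (fst p i, indicator G (fst p i) + snd p i :: real))
        \<in> measurable (?B \<Otimes>\<^sub>M ?R) (sample_space n)"
      unfolding sample_space_def
    proof (rule measurable_restrict)
      fix i assume i: "i \<in> {..<n}"
      have [measurable]: "(\<lambda>p. fst p i) \<in> measurable (?B \<Otimes>\<^sub>M ?R) borel"
        "(\<lambda>p. snd p i) \<in> measurable (?B \<Otimes>\<^sub>M ?R) borel"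
        using i by measurable
      show "(\<lambda>p. (fst p i, indicator G (fst p i) + snd p i)) \<in> measurable (?B \<Otimes>\<^sub>M ?R) borel"
        by measurable
    qed
    then show ?thesis by (simp add: case_prod_unfold)
  qed
  have joint: "distr M ?B ?X \<Otimes>\<^sub>M distr M ?R ?\<xi> = distr M (?B \<Otimes>\<^sub>M ?R) (\<lambda>\<omega>. (?X \<omega>, ?\<xi> \<omega>))"
    using indep by simp
  have rv: "?X \<in> measurable M ?B" "?\<xi> \<in> measurable M ?R"
    by (intro measurable_restrict rvX rv\<xi>; assumption)+
  have "sample_law N n G = distr (distr M (?B \<Otimes>\<^sub>M ?R) (\<lambda>\<omega>. (?X \<omega>, ?\<xi> \<omega>))) (sample_space n) ?f"
    unfolding sample_law_def joint[symmetric] dX d\<xi> ..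
  also have "\<dots> = distr M (sample_space n) (?f \<circ> (\<lambda>\<omega>. (?X \<omega>, ?\<xi> \<omega>)))"
    by (intro distr_distr f measurable_Pair rv)
  also have "?f \<circ> (\<lambda>\<omega>. (?X \<omega>, ?\<xi> \<omega>)) =
      (\<lambda>\<omega>. \<lambda>i\<in>{..<n}. (X i \<omega>, indicator G (X i \<omega>) + \<xi> i \<omega>))"
    by (auto simp: fun_eq_iff)
  finally show ?thesis ..
qed

end

theory Submission
  imports Defs
begin

text \<open>
  The estimator minimises the contrast, so if \<open>|P\<triangle>C|\<close> is large at \<open>P = Phat\<close>, the contrast of
  \<open>P\<close> does not exceed that of a good approximation \<open>Q\<close> of \<open>C\<close>.  For fixed \<open>P\<close>, an exponential
  Markov inequality with a small constant exponent bounds the probability of this event by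
  \<open>exp (n (c |Q\<triangle>C| - \<alpha> |P\<triangle>C|))\<close>.  There are at most \<open>(n + 1)\<^bsup>dr\<^esup>\<close> candidates, so the union
  bound closes as soon as \<open>r ln n\<close> and \<open>n |Q\<triangle>C|\<close> are of order \<open>n (ln n / n)\<^bsup>2/(d+1)\<^esup>\<close>.  Such a \<open>Q\<close> comes
  from the approximation theorem of Bronshtein and Ivanov: \<open>C\<close> is within Hausdorff distance
  \<open>O(r\<^bsup>-2/(d-1)\<^esup>)\<close> of a polytope with \<open>r\<close> vertices, which can be moved to the grid
  at the cost of \<open>O(1/n)\<close>.  Hausdorff distance controls volume since thickening a convex
  subset of the cube by \<open>\<rho>\<close> adds volume \<open>O(\<rho>)\<close>.
\<close>

section \<open>Volume of thickened convex sets\<close>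

text \<open>
  The part of \<open>A + [0,s]v\<close> outside \<open>A\<close> has pairwise disjoint translates by the multiples of \<open>sv\<close>, by
  convexity of \<open>A\<close>; about \<open>1/s\<close> of them fit into a fixed ball.
\<close>

lemma measure_sum_segment_le:
  fixes A :: "'a::euclidean_space set" and R :: real
  assumes A: "compact A" "convex A" "A \<subseteq> cball 0 R" and v: "norm v = 1" and s: "0 < s" "s \<le> 1"
  shows "measure lborel {x + t *\<^sub>R v |x t. x \<in> A \<and> t \<in> {0..s}}
    \<le> measure lborel A + s * measure lborel (cball (0::'a) (R + 3))"
proof -
  define S where "S = {x + t *\<^sub>R v |x t. x \<in> A \<and> t \<in> {0..s}}"
  define D where "D = S - A"
  \<comment> \<open>The bound \<open>1 / s \<le> real m\<close> turns a bound for m copies of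
    \<open>D\<close> into one of order s for a single copy; \<open>real m * s \<le> 2\<close> keeps
    the translates near \<open>A\<close>.\<close>
  define m where "m = nat \<lceil>1 / s\<rceil>"
  define T where "T k = (+) ((real k * s) *\<^sub>R v) ` D" for k
  have m: "1 / s \<le> real m" "real m * s \<le> 2"
  proof -
    show "1 / s \<le> real m" unfolding m_def using s by linarith
    have "real m \<le> 1 / s + 1" unfolding m_def using s by (simp add: of_nat_nat)
    then have "real m * s \<le> (1 / s + 1) * s" using s by (intro mult_right_mono) auto
    also have "\<dots> = 1 + s" using s by (simp add: field_simps)
    finally show "real m * s \<le> 2" using s by simp
  qed
  have "S = (\<lambda>(x, t). x + t *\<^sub>R v) ` (A \<times> {0..s})"
    unfolding S_def by fastforce
  then have cS: "compact S"
    using A by (auto intro!: compact_continuous_image compact_Times continuous_intros simp: case_prod_unfold)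
  have meas0: "S \<in> lmeasurable" "A \<in> lmeasurable"
    using cS A(1) by (auto intro: lmeasurable_compact)
  then have measD: "D \<in> lmeasurable"
    unfolding D_def by (rule fmeasurable.Diff)
  have measT: "T k \<in> lmeasurable" for k
    unfolding T_def by (rule measurable_translation[OF measD])
  note meas = meas0 measD measT
  have disj: "disjoint_family_on T {..<m}"
  proof -
    \<comment> \<open>If two translates met, y would be \<open>a - w *\<^sub>R v\<close> with w
      \<ge> 0, while \<open>b = y - u *\<^sub>R v\<close>. So y lies on the segment from b to a,
      both in \<open>A\<close>, and convexity puts y into \<open>A\<close>, which \<open>D\<close>
      excludes.\<close>
    have *: False if kl: "k < l" and x: "x \<in> D" and y: "y \<in> D"
      and eq: "(real k * s) *\<^sub>R v + x = (real l * s) *\<^sub>R v + y" for k l x y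
    proof -
      obtain a t where a: "a \<in> A" "t \<in> {0..s}" "x = a + t *\<^sub>R v" using x by (auto simp: D_def S_def)
      obtain b u where b: "b \<in> A" "u \<in> {0..s}" "y = b + u *\<^sub>R v" using y by (auto simp: D_def S_def)
      define w where "w = (real l - real k) * s - t"
      have "1 * s \<le> (real l - real k) * s" using kl s by (intro mult_right_mono) auto
      then have w: "0 \<le> w" using a by (auto simp: w_def)
      have ya: "y = a - w *\<^sub>R v"
        using eq unfolding a(3) w_def by (simp add: algebra_simps)
      have "y \<in> A"
      proof (cases "u + w = 0")
        case True
        then have "u = 0" using w b by auto
        then show ?thesis using b by simp
      next
        case False
        then have uw: "u + w > 0" using w b by auto
        have ba: "b = a - (u + w) *\<^sub>R v" using ya b(3) by (simp add: algebra_simps)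
        define p where "p = w / (u + w)"
        define q where "q = u / (u + w)"
        have pq: "p \<ge> 0" "q \<ge> 0" "p + q = 1" "p * (u + w) = w"
          using uw w b by (auto simp: p_def q_def add_divide_distrib[symmetric])
        have "p *\<^sub>R b + q *\<^sub>R a = (p + q) *\<^sub>R a - (p * (u + w)) *\<^sub>R v"
          unfolding ba by (simp add: algebra_simps)
        then have "y = p *\<^sub>R b + q *\<^sub>R a" using pq ya by simp
        then show ?thesis
          using convexD[OF A(2) b(1) a(1) pq(1,2,3)] by simp
      qed
      then show False using y by (auto simp: D_def)
    qed
    show ?thesis
      unfolding disjoint_family_on_def T_def
      using * by (auto, metis linorder_neqE_nat)
  qed
  \<comment> \<open>The radius adds up R for the point of \<open>A\<close>, 2 for the translation
    and 1 for \<open>t \<le> s\<close>.\<close>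
  have sub: "(\<Union>k<m. T k) \<subseteq> cball 0 (R + 3)"
  proof (clarsimp simp: T_def D_def S_def)
    fix k x t assume k: "k < m" and x: "x \<in> A" and t: "0 \<le> t" "t \<le> s"
    have "real k * s \<le> real m * s" using k s by (intro mult_right_mono) auto
    then have "real k * s \<le> 2" using m by simp
    moreover have "norm x \<le> R" using A(3) x by auto
    moreover have "norm ((real k * s) *\<^sub>R v + (x + t *\<^sub>R v)) \<le> real k * s + (norm x + t)"
      using s t v by (intro order_trans[OF norm_triangle_ineq] add_mono order_trans[OF norm_triangle_ineq]) auto
    ultimately show "norm ((real k * s) *\<^sub>R v + (x + t *\<^sub>R v)) \<le> R + 3" using s t by simp
  qed
  have "real m * measure lebesgue D = (\<Sum>k<m. measure lebesgue (T k))"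
    by (simp add: T_def measure_translation)
  also have "\<dots> = measure lebesgue (\<Union>k<m. T k)"
    using fmeasurableD[OF measT] fmeasurableD2[OF measT] disj
    by (intro measure_finite_Union[symmetric]) (blast | simp only: infinity_ennreal_def | rule finite_lessThan)+
  also have "\<dots> \<le> measure lebesgue (cball (0::'a) (R + 3))"
    using sub measT by (intro measure_mono_fmeasurable lmeasurable_cball sets.finite_UN fmeasurableD) simp_all
  finally have *: "real m * measure lebesgue D \<le> measure lebesgue (cball (0::'a) (R + 3))" .
  have "(1 / s) * measure lebesgue D \<le> real m * measure lebesgue D"
    using m by (intro mult_right_mono) auto
  with * have "(1 / s) * measure lebesgue D \<le> measure lebesgue (cball (0::'a) (R + 3))"
    by linarith
  then have D: "measure lebesgue D \<le> s * measure lebesgue (cball (0::'a) (R + 3))"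
    using s by (simp add: field_simps)
  have "measure lebesgue S \<le> measure lebesgue (A \<union> D)"
    using meas by (intro measure_mono_fmeasurable) (auto simp: D_def)
  also have "\<dots> \<le> measure lebesgue A + measure lebesgue D"
    using meas by (intro measure_Un_le) auto
  finally have "measure lebesgue S \<le> measure lebesgue A + s * measure lebesgue (cball (0::'a) (R + 3))"
    using D by simp
  then show ?thesis using cS A(1)
    unfolding S_def[symmetric] by (simp add: measure_completion borel_compact)
qed

text \<open>Induction over the coordinate directions in \<open>J\<close>, each costing one
  application of the segment bound. Compactness, convexity and a ball around \<open>A'\<close> are
  carried along because the next application asks for them.\<close>

lemma measure_thickening_le:
  fixes A :: "'a::euclidean_space set" and R :: real
  assumes A: "compact A" "convex A" "A \<subseteq> cball 0 R" and r: "0 < \<rho>" "\<rho> \<le> 1/2"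
    and J: "J \<subseteq> Basis"
  shows "\<exists>A'. compact A' \<and> convex A' \<and> A' \<subseteq> cball 0 (R + real (card J)) \<and>
     measure lborel A' \<le> measure lborel A
       + real (card J) * (2 * \<rho> * measure lborel (cball (0::'a) (R + DIM('a) + 4))) \<and>
     (\<forall>x\<in>A. \<forall>t. (\<forall>v\<in>J. \<bar>t v\<bar> \<le> \<rho>) \<longrightarrow> x + (\<Sum>v\<in>J. t v *\<^sub>R v) \<in> A')"
  using finite_subset[OF J finite_Basis] J
proof (induction J rule: finite_induct)
  case empty
  then show ?case using A by (intro exI[of _ A]) auto
next
  case (insert v J)
  let ?V = "measure lborel (cball (0::'a) (R + DIM('a) + 4))"
  have "J \<subseteq> Basis" using insert.prems by simp
  from insert.IH[OF this] obtain B where B: "compact B" "convex B" "B \<subseteq> cball 0 (R + real (card J))"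
    "measure lborel B \<le> measure lborel A + real (card J) * (2 * \<rho> * ?V)"
    "\<forall>x\<in>A. \<forall>t. (\<forall>v\<in>J. \<bar>t v\<bar> \<le> \<rho>) \<longrightarrow> x + (\<Sum>v\<in>J. t v *\<^sub>R v) \<in> B"
    by (elim exE conjE)
  have v: "norm v = 1" using insert.prems by auto
  \<comment> \<open>Shifting back by \<rho> turns the one-sided segments [0, 2\<rho>] into the
    symmetric thickening [-\<rho>, \<rho>].\<close>
  define B0 where "B0 = (+) (- \<rho> *\<^sub>R v) ` B"
  define B1 where "B1 = {x + t *\<^sub>R v |x t. x \<in> B0 \<and> t \<in> {0..2 * \<rho>}}"
  have B0: "compact B0" "convex B0"
    unfolding B0_def using B by (intro compact_translation convex_translation; simp)+
  have B0n: "norm x \<le> R + real (card J) + \<rho>" if x: "x \<in> B0" for x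
  proof -
    obtain y where y: "y \<in> B" "x = - \<rho> *\<^sub>R v + y" using x[unfolded B0_def] by (elim imageE)
    have "norm x \<le> norm (- \<rho> *\<^sub>R v) + norm y" unfolding y by (rule norm_triangle_ineq)
    then show ?thesis using y B(3) v r by auto
  qed
  have "measure lebesgue B0 = measure lebesgue B"
    unfolding B0_def by (rule measure_translation)
  then have B0m: "measure lborel B0 = measure lborel B"
    using B(1) B0(1) by (simp add: measure_completion borel_compact)
  have im: "B1 = (\<lambda>(x, t). x + t *\<^sub>R v) ` (B0 \<times> {0..2 * \<rho>})"
    unfolding B1_def by fastforce
  have "compact B1"
    unfolding im using B0
    by (auto intro!: compact_continuous_image compact_Times continuous_intros simp: case_prod_unfold)
  moreover have "convex B1"
    unfolding im using B0
    by (auto intro!: convex_linear_image convex_Times linearI simp: case_prod_unfold algebra_simps)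
  moreover have "B1 \<subseteq> cball 0 (R + real (card (insert v J)))"
  proof
    fix z assume "z \<in> B1"
    then obtain x t where x: "x \<in> B0" and t: "0 \<le> t" "t \<le> 2 * \<rho>" and z: "z = x + t *\<^sub>R v"
      unfolding B1_def by auto
    define y where "y = x + \<rho> *\<^sub>R v"
    have "y \<in> B" using x by (auto simp: y_def B0_def)
    then have "norm y \<le> R + real (card J)" using B(3) by auto
    moreover have "z = y + (t - \<rho>) *\<^sub>R v" by (simp add: y_def z algebra_simps)
    then have "norm z \<le> norm y + \<bar>t - \<rho>\<bar>"
      using norm_triangle_ineq[of y "(t - \<rho>) *\<^sub>R v"] v by simp
    moreover have "card (insert v J) = card J + 1" using insert.hyps by simp
    ultimately show "z \<in> cball 0 (R + real (card (insert v J)))"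
      using t r by simp
  qed
  moreover have "measure lborel B1 \<le> measure lborel A + real (card (insert v J)) * (2 * \<rho> * ?V)"
  proof -
    have "card (insert v J) \<le> DIM('a)"
      using insert.prems by (intro card_mono finite_Basis)
    then have c: "real (card J) + 1 \<le> real DIM('a)" using insert by simp
    \<comment> \<open>Since card J + 1 \<le> DIM and \<rho> \<le> 1/2, the ball of radius
      \<open>R + DIM('a) + 4\<close> contains the balls of all induction steps, so the increments
      share one constant.\<close>
    have "measure lborel B1 \<le> measure lborel B0 +
        (2 * \<rho>) * measure lborel (cball (0::'a) ((R + real (card J) + \<rho>) + 3))"
      unfolding B1_def using B0 B0n v r
      by (intro measure_sum_segment_le) auto
    also have "\<dots> \<le> measure lborel B + (2 * \<rho>) * ?V"
      unfolding B0m using r c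
      by (intro add_left_mono mult_left_mono measure_mono_fmeasurable) (auto intro: fmeasurable_compact)
    also note B(4)
    finally show ?thesis using insert.hyps by (simp add: algebra_simps)
  qed
  moreover have "x + (\<Sum>w\<in>insert v J. t w *\<^sub>R w) \<in> B1"
    if x: "x \<in> A" and t: "\<forall>w\<in>insert v J. \<bar>t w\<bar> \<le> \<rho>" for x t
  proof -
    have y: "x + (\<Sum>v\<in>J. t v *\<^sub>R v) \<in> B" using x t by (intro B(5)[rule_format]) auto
    have "x + (\<Sum>w\<in>insert v J. t w *\<^sub>R w)
        = (- \<rho> *\<^sub>R v + (x + (\<Sum>v\<in>J. t v *\<^sub>R v))) + (t v + \<rho>) *\<^sub>R v"
      using insert.hyps by (simp add: algebra_simps)
    moreover have "- \<rho> *\<^sub>R v + (x + (\<Sum>v\<in>J. t v *\<^sub>R v)) \<in> B0"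
      unfolding B0_def using y by blast
    moreover have "t v + \<rho> \<in> {0..2 * \<rho>}" using t by auto
    ultimately show ?thesis unfolding B1_def by blast
  qed
  ultimately show ?case by blast
qed

text \<open>Coordinates of a vector are bounded by its norm, so thickening \<open>A\<close> along
  all of \<open>Basis\<close> covers every point within distance \<rho> of \<open>A\<close>.\<close>

lemma measure_cball_sum_le:
  fixes A :: "'a::euclidean_space set" and R :: real
  assumes A: "compact A" "convex A" "A \<subseteq> cball 0 R" and r: "0 < \<rho>" "\<rho> \<le> 1/2"
    and B: "B \<in> sets borel" "\<And>y. y \<in> B \<Longrightarrow> \<exists>x\<in>A. dist x y \<le> \<rho>"
  shows "measure lborel B \<le> measure lborel A
    + 2 * real DIM('a) * measure lborel (cball (0::'a) (R + DIM('a) + 4)) * \<rho>"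
proof -
  obtain A' where A': "compact A'"
     "measure lborel A' \<le> measure lborel A
       + real DIM('a) * (2 * \<rho> * measure lborel (cball (0::'a) (R + DIM('a) + 4)))"
     "\<And>x t. x \<in> A \<Longrightarrow> (\<forall>v\<in>Basis. \<bar>t v\<bar> \<le> \<rho>) \<Longrightarrow> x + (\<Sum>v\<in>Basis. t v *\<^sub>R v) \<in> A'"
    using measure_thickening_le[OF A r order_refl] by blast
  have "B \<subseteq> A'"
  proof
    fix y assume "y \<in> B"
    then obtain x where x: "x \<in> A" "dist x y \<le> \<rho>" using B by blast
    have "x + (\<Sum>v\<in>Basis. ((y - x) \<bullet> v) *\<^sub>R v) \<in> A'"
    proof (rule A'(3)[OF x(1)], intro ballI)
      fix v :: 'a assume "v \<in> Basis"
      then have "\<bar>(y - x) \<bullet> v\<bar> \<le> norm (y - x)" by (rule Basis_le_norm)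
      then show "\<bar>(y - x) \<bullet> v\<bar> \<le> \<rho>" using x by (simp add: dist_norm norm_minus_commute)
    qed
    then show "y \<in> A'" by (simp add: euclidean_representation)
  qed
  then have "measure lborel B \<le> measure lborel A'"
    using A'(1) B(1) by (intro measure_mono_fmeasurable) (auto intro: fmeasurable_compact)
  with A'(2) show ?thesis by (simp add: algebra_simps)
qed

text \<open>The union lies in the \<rho>-neighbourhood of either set, so it exceeds each of them by
  O(\<rho>) in volume, and these two excesses make up the symmetric difference.\<close>

lemma measure_sym_diff_le:
  fixes A B :: "'a::euclidean_space set" and R :: real
  assumes A: "compact A" "convex A" "A \<subseteq> cball 0 R"
    and B: "compact B" "convex B" "B \<subseteq> cball 0 R"
    and r: "0 < \<rho>" "\<rho> \<le> 1/2"
    and AB: "\<And>x. x \<in> A \<Longrightarrow> \<exists>y\<in>B. dist y x \<le> \<rho>" "\<And>y. y \<in> B \<Longrightarrow> \<exists>x\<in>A. dist x y \<le> \<rho>"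
  shows "measure lborel (sym_diff A B)
    \<le> 4 * real DIM('a) * measure lborel (cball (0::'a) (R + DIM('a) + 4)) * \<rho>"
proof -
  let ?K = "2 * real DIM('a) * measure lborel (cball (0::'a) (R + DIM('a) + 4)) * \<rho>"
  have fm: "A \<in> fmeasurable lborel" "B \<in> fmeasurable lborel" "A \<union> B \<in> fmeasurable lborel"
    using A B by (auto intro: fmeasurable_compact)
  have bo: "A \<union> B \<in> sets borel" using A B by (auto intro: borel_compact)
  have "measure lborel (A \<union> B) \<le> measure lborel A + ?K"
    using AB r order_less_imp_le[OF r(1)] by (intro measure_cball_sum_le[OF A r bo]) (force simp: dist_self)
  moreover have "measure lborel (A \<union> B) \<le> measure lborel B + ?K"
    using AB r order_less_imp_le[OF r(1)] by (intro measure_cball_sum_le[OF B r bo]) (force simp: dist_self)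
  moreover have "measure lborel (A \<union> B - A) = measure lborel (A \<union> B) - measure lborel A"
    "measure lborel (A \<union> B - B) = measure lborel (A \<union> B) - measure lborel B"
    using fm by (auto intro!: measurable_measure_Diff simp: fmeasurableD)
  moreover have "measure lborel (sym_diff A B)
      \<le> measure lborel (A \<union> B - B) + measure lborel (A \<union> B - A)"
  proof -
    have "sym_diff A B = (A \<union> B - B) \<union> (A \<union> B - A)" by auto
    then show ?thesis using fm by (metis measure_Un_le sets.Diff fmeasurableD)
  qed
  ultimately show ?thesis by simp
qed

section \<open>Approximation by grid polytopes\<close>

text \<open>
  The construction of Bronshtein and Ivanov: a \<open>\<delta>\<close>-net of a surface around \<open>C\<close>, projected to \<open>C\<close>,
  spans a polytope at distance at most \<open>\<delta>\<^sup>2\<close>. The second order comes from adding up the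
  variational inequalities of the projections of a point \<open>z\<close> of the surface and of its neighbour
  in the net.
\<close>

lemma convex_hull_closest_points_approx:
  fixes C S Z :: "'a::euclidean_space set"
  assumes C: "compact C" "convex C" "C \<noteq> {}"
    and S: "bounded S" "C \<subseteq> interior S" "\<And>x z. x \<in> C \<Longrightarrow> z \<in> frontier S \<Longrightarrow> 1 \<le> dist x z"
    and Z: "finite Z" "Z \<noteq> {}" "\<And>z. z \<in> frontier S \<Longrightarrow> \<exists>w\<in>Z. dist z w \<le> \<delta>"
    and c: "c \<in> C"
  shows "\<exists>p\<in>convex hull (closest_point C ` Z). dist c p \<le> \<delta>\<^sup>2"
proof (rule ccontr)
  let ?P = "convex hull (closest_point C ` Z)"
  assume neg: "\<not> (\<exists>p\<in>?P. dist c p \<le> \<delta>\<^sup>2)"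
  have P: "compact ?P" "convex ?P" "?P \<noteq> {}"
    using Z by (auto intro: compact_convex_hull finite_imp_compact)
  define p where "p = closest_point ?P c"
  have p: "p \<in> ?P" unfolding p_def using P by (intro closest_point_in_set compact_imp_closed)
  have gap: "dist c p > \<delta>\<^sup>2" using neg p by force
  then have pos: "norm (c - p) > 0" by (smt (verit) dist_norm zero_le_power2)
  \<comment> \<open>The unit normal of a hyperplane that separates \<open>c\<close> from the
    polytope with a margin of more than \<open>\<delta>\<^sup>2\<close>.\<close>
  define u where "u = (c - p) /\<^sub>R norm (c - p)"
  have u: "norm u = 1" "u \<noteq> 0" using pos by (auto simp: u_def)
  have uq: "u \<bullet> q + \<delta>\<^sup>2 < u \<bullet> c" if "q \<in> ?P" for q
  proof -
    have "(c - p) \<bullet> (q - p) \<le> 0"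
      unfolding p_def using P that by (intro closest_point_dot compact_imp_closed)
    then have "u \<bullet> (q - p) \<le> 0"
      using pos by (simp add: u_def mult_le_0_iff)
    moreover have "u \<bullet> (c - p) = norm (c - p)"
      using pos by (simp add: u_def dot_square_norm power2_eq_square)
    ultimately show ?thesis using gap by (simp add: inner_diff_right dist_norm)
  qed
  \<comment> \<open>As x is extremal in \<open>C\<close> in direction u, the point z on the ray from
    x along u projects to x. The inequality \<open>2\<close> below is the variational inequality of
    this projection, tested at q.\<close>
  obtain x where x: "x \<in> C" "\<And>y. y \<in> C \<Longrightarrow> u \<bullet> y \<le> u \<bullet> x"
    using continuous_attains_sup[OF C(1,3) continuous_on_inner[OF continuous_on_const continuous_on_id]]
    by blast
  obtain t where t: "0 < t" "x + t *\<^sub>R u \<in> frontier S"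
    using ray_to_frontier[OF S(1) _ u(2), of x] x(1) S(2) by blast
  define z where "z = x + t *\<^sub>R u"
  have "1 \<le> dist x z" unfolding z_def by (rule S(3)[OF x(1) t(2)])
  then have t1: "1 \<le> t" using u t by (simp add: z_def dist_norm)
  obtain w where w: "w \<in> Z" "dist z w \<le> \<delta>" using Z(3) t(2) by (auto simp: z_def)
  define q where "q = closest_point C w"
  have q: "q \<in> C" "q \<in> ?P"
    using C w by (auto simp: q_def intro: closest_point_in_set compact_imp_closed hull_inc)
  have 1: "(w - q) \<bullet> (x - q) \<le> 0"
    unfolding q_def using C x by (intro closest_point_dot compact_imp_closed)
  have 2: "t * (u \<bullet> (x - q)) \<ge> 0" using x(2)[OF q(1)] t by (simp add: inner_diff_right)
  \<comment> \<open>The two variational inequalities make the first and the last term nonnegative.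
    With Cauchy-Schwarz on the left this gives first \<open>norm (x - q) \<le> \<delta>\<close>, and
    then \<open>\<delta>\<^sup>2\<close> as a bound for the first term.\<close>
  have key: "(z - w) \<bullet> (x - q) = t * (u \<bullet> (x - q)) + (norm (x - q))\<^sup>2 - (w - q) \<bullet> (x - q)"
    by (simp add: z_def power2_norm_eq_inner algebra_simps)
  have cs: "(z - w) \<bullet> (x - q) \<le> \<delta> * norm (x - q)"
    using w(2) by (intro order_trans[OF norm_cauchy_schwarz] mult_right_mono) (auto simp: dist_norm)
  have "norm (x - q) * norm (x - q) \<le> \<delta> * norm (x - q)"
    using key cs 1 2 by (simp add: power2_eq_square)
  then have "norm (x - q) \<le> \<delta>"
    by (metis mult_right_le_imp_le norm_ge_zero order_le_less w(2) zero_le_dist order_trans)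
  moreover have d: "0 \<le> \<delta>" using w(2) zero_le_dist order_trans by blast
  ultimately have "\<delta> * norm (x - q) \<le> \<delta> * \<delta>" by (intro mult_left_mono)
  then have "t * (u \<bullet> (x - q)) \<le> \<delta>\<^sup>2" using key cs 1 zero_le_power2[of "norm (x - q)"]
    unfolding power2_eq_square by linarith
  moreover have "1 * (u \<bullet> (x - q)) \<le> t * (u \<bullet> (x - q))"
    using t1 x(2)[OF q(1)] by (intro mult_right_mono) (auto simp: inner_diff_right)
  ultimately have "u \<bullet> x \<le> u \<bullet> q + \<delta>\<^sup>2" by (simp add: inner_diff_right)
  then show False using uq[OF q(2)] x(2)[OF c] by simp
qed

lemma card_vec_set_le:
  fixes B :: "'d::finite \<Rightarrow> 'b set"
  assumes "\<And>i. finite (B i)"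
  shows "finite {x :: 'b ^ 'd. \<forall>i. x $ i \<in> B i}"
    "card {x :: 'b ^ 'd. \<forall>i. x $ i \<in> B i} \<le> (\<Prod>i\<in>UNIV. card (B i))"
proof -
  have eq: "{x :: 'b ^ 'd. \<forall>i. x $ i \<in> B i} = (\<lambda>f. \<chi> i. f i) ` (PiE UNIV B)" (is "_ = ?f ` _")
  proof (intro equalityI subsetI)
    fix x :: "'b ^ 'd" assume "x \<in> {x. \<forall>i. x $ i \<in> B i}"
    then have "($) x \<in> PiE UNIV B" "x = ?f (($) x)" by auto
    then show "x \<in> ?f ` PiE UNIV B" by blast
  qed auto
  have fin: "finite (PiE UNIV B)" using assms by (intro finite_PiE) auto
  show "finite {x :: 'b ^ 'd. \<forall>i. x $ i \<in> B i}" unfolding eq using fin by simp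
  show "card {x :: 'b ^ 'd. \<forall>i. x $ i \<in> B i} \<le> (\<Prod>i\<in>UNIV. card (B i))"
    unfolding eq using card_image_le[OF fin, of ?f] by (simp add: card_PiE)
qed

text \<open>The net consists of a grid of mesh 3/m on each of the 2d faces. A face fixes one
  coordinate, hence the exponent d - 1, from which the exponent of the approximation rate
  comes.\<close>

lemma cube_frontier_net:
  assumes m: "0 < m"
  shows "\<exists>Z :: (real ^ 'd::finite) set. finite Z \<and> Z \<noteq> {} \<and>
    card Z \<le> 2 * CARD('d) * (m + 1) ^ (CARD('d) - 1) \<and>
    (\<forall>z\<in>frontier (cbox (- 1) 2). \<exists>w\<in>Z. dist z w \<le> 3 * real CARD('d) / real m)"
proof -
  define g where "g k = 3 * real k / real m - 1" for k :: nat
  define \<Gamma> where "\<Gamma> = g ` {..m}"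
  have \<Gamma>: "finite \<Gamma>" "card \<Gamma> \<le> m + 1"
    using card_image_le[of "{..m}" g] by (auto simp: \<Gamma>_def)
  have \<Gamma>b: "-1 \<in> \<Gamma>" "2 \<in> \<Gamma>"
    unfolding \<Gamma>_def using m by (auto simp: g_def intro: image_eqI[of _ _ 0] image_eqI[of _ _ m])
  define W where "W = (\<lambda>(j::'d, b::real). {x :: real ^ 'd. \<forall>i. x $ i \<in> (if i = j then {b} else \<Gamma>)})"
  define Z where "Z = (\<Union>p\<in>UNIV \<times> {-1, 2}. W p)"
  have W: "finite (W p)" "card (W p) \<le> (m + 1) ^ (CARD('d) - 1)" for p
  proof -
    obtain j b where p: "p = (j, b)" by (cases p)
    show "finite (W p)"
      unfolding W_def p prod.case using \<Gamma> by (intro card_vec_set_le) auto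
    have "card (W p) \<le> (\<Prod>i\<in>UNIV. card (if i = j then {b} else \<Gamma>))"
      unfolding W_def p prod.case using \<Gamma> by (intro card_vec_set_le) auto
    also have "\<dots> = (\<Prod>i\<in>UNIV - {j}. card \<Gamma>)"
      by (subst prod.remove[of UNIV j]) auto
    also have "\<dots> = card \<Gamma> ^ (CARD('d) - 1)" by simp
    also have "\<dots> \<le> (m + 1) ^ (CARD('d) - 1)" using \<Gamma> by (intro power_mono) auto
    finally show "card (W p) \<le> (m + 1) ^ (CARD('d) - 1)" .
  qed
  have "finite Z" unfolding Z_def using W by auto
  moreover have "card Z \<le> 2 * CARD('d) * (m + 1) ^ (CARD('d) - 1)"
  proof -
    have "card Z \<le> (\<Sum>p\<in>UNIV \<times> {-1, 2}. card (W p))"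
      unfolding Z_def by (intro card_UN_le) auto
    also have "\<dots> \<le> (\<Sum>p\<in>(UNIV :: 'd set) \<times> {-1, 2::real}. (m + 1) ^ (CARD('d) - 1))"
      using W by (intro sum_mono)
    also have "\<dots> = 2 * CARD('d) * (m + 1) ^ (CARD('d) - 1)" by (simp add: card_cartesian_product)
    finally show ?thesis .
  qed
  moreover have net: "\<exists>w\<in>Z. dist z w \<le> 3 * real CARD('d) / real m"
    if z: "z \<in> frontier (cbox (- 1) 2)" for z :: "real ^ 'd"
  proof -
    have zc: "-1 \<le> z $ i" "z $ i \<le> 2" for i
      using z by (auto simp: frontier_cbox mem_box_cart)
    have "\<not> (\<forall>i. -1 < z $ i \<and> z $ i < 2)" using z by (auto simp: frontier_cbox mem_box_cart)
    then obtain j where "\<not> (-1 < z $ j \<and> z $ j < 2)" by blast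
    then have j: "z $ j = -1 \<or> z $ j = 2" using zc[of j] by auto
    define k where "k y = nat \<lfloor>(y + 1) * real m / 3\<rfloor>" for y :: real
    have k: "g (k y) \<in> \<Gamma>" "\<bar>y - g (k y)\<bar> \<le> 3 / real m" if y: "-1 \<le> y" "y \<le> 2" for y
    proof -
      have n0: "0 \<le> (y + 1) * real m / 3" using y by simp
      have "(y + 1) * real m \<le> 3 * real m" using y by (intro mult_right_mono) auto
      then have "(y + 1) * real m / 3 \<le> real m" by simp
      then have "k y \<le> m" unfolding k_def using n0 by linarith
      then show "g (k y) \<in> \<Gamma>" by (auto simp: \<Gamma>_def)
      have "\<bar>(y + 1) * real m / 3 - real (k y)\<bar> \<le> 1" unfolding k_def using n0 by linarith
      then have "\<bar>(y + 1) * real m / 3 - real (k y)\<bar> * (3 / real m) \<le> 1 * (3 / real m)"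
        by (intro mult_right_mono) auto
      also have "\<bar>(y + 1) * real m / 3 - real (k y)\<bar> * (3 / real m)
          = \<bar>((y + 1) * real m / 3 - real (k y)) * (3 / real m)\<bar>" unfolding abs_mult by simp
      also have "((y + 1) * real m / 3 - real (k y)) * (3 / real m) = y - g (k y)"
        using m by (simp add: g_def field_simps)
      finally show "\<bar>y - g (k y)\<bar> \<le> 3 / real m" by simp
    qed
    \<comment> \<open>The coordinate that is -1 or 2 is kept, so rounding the others stays on the
      same face; the errors, at most 3/m each, are added up in the 1-norm.\<close>
    define w where "w = (\<chi> i. if i = j then z $ j else g (k (z $ i)))"
    have "w \<in> W (j, z $ j)"
      unfolding W_def using k(1) zc by (auto simp: w_def)
    then have "w \<in> Z" unfolding Z_def using j by auto
    moreover have "dist z w \<le> 3 * real CARD('d) / real m"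
    proof -
      have "dist z w \<le> (\<Sum>i\<in>UNIV. \<bar>(z - w) $ i\<bar>)"
        unfolding dist_norm by (rule norm_le_l1_cart)
      also have "\<dots> \<le> (\<Sum>i\<in>(UNIV::'d set). 3 / real m)"
        using k(2) zc by (intro sum_mono) (auto simp: w_def)
      finally show ?thesis by (simp add: mult.commute)
    qed
    ultimately show ?thesis by blast
  qed
  moreover have "Z \<noteq> {}"
  proof -
    have "(\<chi> i. -1) \<in> W (undefined, -1)" unfolding W_def using \<Gamma>b by auto
    then show ?thesis unfolding Z_def by blast
  qed
  ultimately show ?thesis by blast
qed

section \<open>Grid polytopes and rounding to the grid\<close>

lemma convex_hull_in_grid_polytopes:
  fixes V :: "(real ^ 'd) set"
  assumes "finite V" "card V \<le> r" "V \<subseteq> cbox 0 1" "interior (convex hull V) \<noteq> {}"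
    and grid: "\<And>v i. v \<in> V \<Longrightarrow> \<exists>k::int. v $ i = real_of_int k / real n"
  shows "convex hull V \<in> grid_polytopes r n"
proof -
  have sub: "{v. v extreme_point_of (convex hull V)} \<subseteq> V"
    using extreme_point_of_convex_hull by blast
  then have "card {v. v extreme_point_of (convex hull V)} \<le> r"
    using assms(1,2) card_mono order_trans by blast
  moreover have "convex hull V \<subseteq> cbox 0 1"
    using assms(3) by (intro hull_minimal convex_box)
  ultimately show ?thesis
    unfolding grid_polytopes_def using assms sub by (auto intro: polytope_convex_hull)
qed

lemma grid_polytopesD:
  assumes "P \<in> grid_polytopes r n"
  shows "compact P" "convex P" "P \<subseteq> cbox 0 1"
  using assms by (auto simp: grid_polytopes_def polytope_imp_compact polytope_imp_convex)

lemma measure_unit_cube: "measure lborel (cbox 0 1 :: (real ^ 'd::finite) set) = 1"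
  by (subst content_cbox_cart) (auto simp: interval_ne_empty_cart)

lemma measure_subset_unit_cube_le_1:
  fixes A :: "(real ^ 'd::finite) set"
  assumes "A \<subseteq> cbox 0 1" "A \<in> sets borel"
  shows "measure lborel A \<le> 1"
  using measure_mono_fmeasurable[OF assms(1), of lborel] assms(2)
  by (simp add: measure_unit_cube fmeasurable_compact)

text \<open>A fallback candidate for the cases where the error bound is trivial or the approximating
  hull is flat. The simplex spanned by 0 and the vectors e_i / n has d + 1 vertices and fits into a
  cube of side 1/n.\<close>

lemma small_simplex_grid_polytope:
  assumes n: "0 < n" and r: "CARD('d::finite) + 1 \<le> r"
  shows "\<exists>T \<in> grid_polytopes r n. measure lborel (T :: (real ^ 'd) set) \<le> 1 / real n"
proof -
  let ?B = "(\<lambda>b :: real ^ 'd. (1 / real n) *\<^sub>R b) ` Basis"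
  have inj: "inj_on (\<lambda>b :: real ^ 'd. (1 / real n) *\<^sub>R b) Basis"
    using n by (auto simp: inj_on_def)
  have card: "card ?B = DIM(real ^ 'd)" using inj by (rule card_image)
  have ind: "independent ?B"
    using n by (intro linear_independent_injective_image[OF _ independent_Basis])
      (auto simp: inj_on_def intro!: linearI simp: algebra_simps)
  have int: "interior (convex hull (insert 0 ?B)) \<noteq> {}"
    using interior_simplex_nonempty[OF ind _ card] by auto
  have sub: "insert 0 ?B \<subseteq> cbox 0 (\<chi> i. 1 / real n)"
    by (auto simp: mem_box_cart Basis_vec_def axis_def)
  have sub1: "cbox 0 (\<chi> i. 1 / real n) \<subseteq> (cbox 0 1 :: (real ^ 'd) set)"
  proof
    fix x :: "real ^ 'd" assume "x \<in> cbox 0 (\<chi> i. 1 / real n)"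
    then have "0 \<le> x $ i" "x $ i \<le> 1 / real n" for i by (auto simp: mem_box_cart)
    moreover have "1 / real n \<le> 1" using n by simp
    ultimately show "x \<in> cbox 0 1" by (auto simp: mem_box_cart intro: order_trans)
  qed
  have "convex hull (insert 0 ?B) \<in> grid_polytopes r n"
  proof (rule convex_hull_in_grid_polytopes)
    have "card (insert 0 ?B) \<le> card ?B + 1" by (simp add: card_insert_if)
    then show "card (insert 0 ?B) \<le> r" using card r by simp
    show "insert 0 ?B \<subseteq> cbox 0 1" using sub sub1 by blast
    fix v i assume "v \<in> insert 0 ?B"
    then have "v $ i = real_of_int 0 / real n \<or> v $ i = real_of_int 1 / real n"
      by (auto simp: Basis_vec_def axis_def)
    then show "\<exists>k::int. v $ i = real_of_int k / real n" by blast
  qed (use int in auto)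
  moreover have "measure lborel (convex hull (insert 0 ?B)) \<le> 1 / real n"
  proof -
    have "convex hull (insert 0 ?B) \<subseteq> cbox 0 (\<chi> i. 1 / real n)"
      using sub by (intro hull_minimal convex_box)
    then have "measure lborel (convex hull (insert 0 ?B))
        \<le> measure lborel (cbox 0 (\<chi> i. 1 / real n) :: (real ^ 'd) set)"
      by (intro measure_mono_fmeasurable fmeasurable_compact compact_cbox)
         (simp_all add: borel_compact compact_convex_hull finite_imp_compact)
    also have "\<dots> = (1 / real n) ^ CARD('d)"
      by (subst content_cbox_cart) (auto simp: interval_ne_empty_cart)
    also have "\<dots> \<le> (1 / real n) ^ 1"
      using n by (intro power_decreasing) (auto simp: Suc_le_eq)
    finally show ?thesis by simp
  qed
  ultimately show ?thesis by blast
qed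

lemma unit_cube_subset_cball: "(cbox 0 1 :: (real ^ 'd::finite) set) \<subseteq> cball 0 (real CARD('d))"
proof
  fix x :: "real ^ 'd" assume "x \<in> cbox 0 1"
  then have "\<bar>x $ i\<bar> \<le> 1" for i by (auto simp: mem_box_cart abs_le_iff intro: order_trans[of _ 0])
  then have "(\<Sum>i\<in>UNIV. \<bar>x $ i\<bar>) \<le> (\<Sum>i\<in>(UNIV :: 'd set). 1)" by (intro sum_mono)
  then show "x \<in> cball 0 (real CARD('d))" using norm_le_l1_cart[of x] by simp
qed

lemma convex_hull_image_near:
  fixes f :: "'a::euclidean_space \<Rightarrow> 'a"
  assumes f: "\<And>v. v \<in> V \<Longrightarrow> dist v (f v) \<le> \<eta>" and p: "p \<in> convex hull V"
  shows "\<exists>q\<in>convex hull (f ` V). dist p q \<le> \<eta>"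
proof -
  have "convex hull V \<subseteq> (convex hull (f ` V)) + cball 0 \<eta>"
  proof (rule hull_minimal)
    show "V \<subseteq> (convex hull (f ` V)) + cball 0 \<eta>"
    proof
      fix v assume "v \<in> V"
      then have "f v \<in> convex hull (f ` V)" "v - f v \<in> cball 0 \<eta>"
        using f by (auto intro: hull_inc simp: dist_norm norm_minus_commute)
      then show "v \<in> (convex hull (f ` V)) + cball 0 \<eta>"
        by (auto simp: set_plus_def intro!: bexI)
    qed
  qed (intro convex_set_plus convex_convex_hull convex_cball)
  then show ?thesis using p by (force simp: set_plus_def dist_norm)
qed

definition grid_round :: "nat \<Rightarrow> real ^ 'd \<Rightarrow> real ^ 'd" where
  "grid_round n x = (\<chi> i. real_of_int \<lfloor>x $ i * real n\<rfloor> / real n)"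

text \<open>Both 0 and 1 are multiples of 1/n, so rounding down does not leave the cube.\<close>

lemma grid_round:
  fixes x :: "real ^ 'd::finite"
  assumes "0 < n" "x \<in> cbox 0 1"
  shows "grid_round n x \<in> cbox 0 1" "dist x (grid_round n x) \<le> real CARD('d) / real n"
proof -
  have 1: "0 \<le> real_of_int \<lfloor>x $ i * real n\<rfloor> / real n" "real_of_int \<lfloor>x $ i * real n\<rfloor> / real n \<le> 1"
    "\<bar>x $ i - real_of_int \<lfloor>x $ i * real n\<rfloor> / real n\<bar> \<le> 1 / real n" for i
  proof -
    have x: "0 \<le> x $ i" "x $ i \<le> 1" using assms by (auto simp: mem_box_cart)
    show "0 \<le> real_of_int \<lfloor>x $ i * real n\<rfloor> / real n" using x by simp
    have "x $ i * real n \<le> 1 * real n" using x by (intro mult_right_mono) auto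
    then have "real_of_int \<lfloor>x $ i * real n\<rfloor> \<le> real n" by linarith
    then show "real_of_int \<lfloor>x $ i * real n\<rfloor> / real n \<le> 1" using assms(1) by simp
    have "x $ i - real_of_int \<lfloor>x $ i * real n\<rfloor> / real n = (x $ i * real n - real_of_int \<lfloor>x $ i * real n\<rfloor>) / real n"
      using assms(1) by (simp add: field_simps)
    moreover have "\<bar>x $ i * real n - real_of_int \<lfloor>x $ i * real n\<rfloor>\<bar> \<le> 1" by linarith
    ultimately show "\<bar>x $ i - real_of_int \<lfloor>x $ i * real n\<rfloor> / real n\<bar> \<le> 1 / real n"
      using assms(1) by (simp add: divide_right_mono)
  qed
  show "grid_round n x \<in> cbox 0 1" using 1 by (auto simp: grid_round_def mem_box_cart)
  have "dist x (grid_round n x) \<le> (\<Sum>i\<in>UNIV. \<bar>(x - grid_round n x) $ i\<bar>)"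
    unfolding dist_norm by (rule norm_le_l1_cart)
  also have "\<dots> \<le> (\<Sum>i\<in>(UNIV :: 'd set). 1 / real n)"
    using 1 by (intro sum_mono) (auto simp: grid_round_def)
  finally show "dist x (grid_round n x) \<le> real CARD('d) / real n" by simp
qed

text \<open>The squared term is the error of projecting the net to \<open>C\<close>, the term d/n
  that of rounding the projections. The result is a vertex set and not a member of the class because
  its hull may have empty interior.\<close>

lemma grid_polytope_near_convex_body:
  fixes C :: "(real ^ 'd::finite) set"
  assumes C: "C \<in> convex_bodies" and n: "0 < n" and m: "0 < m"
    and r: "2 * CARD('d) * (m + 1) ^ (CARD('d) - 1) \<le> r"
  shows "\<exists>V. finite V \<and> card V \<le> r \<and> V \<subseteq> cbox 0 1 \<and>
     (\<forall>v\<in>V. \<forall>i. \<exists>k::int. v $ i = real_of_int k / real n) \<and>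
     (\<forall>c\<in>C. \<exists>p\<in>convex hull V. dist p c \<le> (3 * real CARD('d) / real m)\<^sup>2 + real CARD('d) / real n) \<and>
     (\<forall>p\<in>convex hull V. \<exists>c\<in>C. dist c p \<le> (3 * real CARD('d) / real m)\<^sup>2 + real CARD('d) / real n)"
proof -
  let ?\<delta> = "3 * real CARD('d) / real m" and ?\<eta> = "real CARD('d) / real n"
  have C: "compact C" "convex C" "C \<noteq> {}" "C \<subseteq> cbox 0 1"
    using C interior_subset by (auto simp: convex_bodies_def)
  obtain Z :: "(real ^ 'd) set" where Z: "finite Z" "Z \<noteq> {}"
    "card Z \<le> 2 * CARD('d) * (m + 1) ^ (CARD('d) - 1)"
    "\<And>z. z \<in> frontier (cbox (- 1) 2) \<Longrightarrow> \<exists>w\<in>Z. dist z w \<le> ?\<delta>"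
    using cube_frontier_net[OF m] by metis
  define X where "X = closest_point C ` Z"
  have X: "X \<subseteq> C" "X \<subseteq> cbox 0 1"
    unfolding X_def using C by (auto intro!: closest_point_in_set compact_imp_closed subsetD[OF C(4)])
  have hX: "convex hull X \<subseteq> C" using X C by (intro hull_minimal)
  define V where "V = grid_round n ` X"
  have near: "\<exists>p\<in>convex hull X. dist c p \<le> ?\<delta>\<^sup>2" if "c \<in> C" for c
    unfolding X_def
  proof (rule convex_hull_closest_points_approx[OF C(1-3) _ _ _ Z(1,2,4) that])
    \<comment> \<open>The boundary of the cube [-1,2]^d serves as the surface, since it has distance
      1 from the unit cube.\<close>
    show "C \<subseteq> interior (cbox (- 1) 2)"
    proof
      fix x assume "x \<in> C"
      then have "0 \<le> x $ i" "x $ i \<le> 1" for i using C(4) by (auto simp: mem_box_cart)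
      then have "-1 < x $ i" "x $ i < 2" for i by (smt (verit))+
      then show "x \<in> interior (cbox (- 1) 2)" by (simp add: interior_cbox mem_box_cart)
    qed
    fix x z :: "real ^ 'd" assume x: "x \<in> C" and z: "z \<in> frontier (cbox (- 1) 2)"
    have "\<not> (\<forall>i. -1 < z $ i \<and> z $ i < 2)" using z by (auto simp: frontier_cbox mem_box_cart)
    then obtain j where "\<not> (-1 < z $ j \<and> z $ j < 2)" by blast
    moreover have "0 \<le> x $ j" "x $ j \<le> 1" using x C(4) by (auto simp: mem_box_cart)
    ultimately have "1 \<le> \<bar>(x - z) $ j\<bar>" by auto
    also have "\<dots> \<le> dist x z" unfolding dist_norm by (rule component_le_norm_cart)
    finally show "1 \<le> dist x z" .
  qed simp
  have rnd: "dist x (grid_round n x) \<le> ?\<eta>" if "x \<in> X" for x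
    using grid_round[OF n] that X by blast
  show ?thesis
  proof (intro exI[of _ V] conjI ballI allI)
    show "finite V" using Z by (simp add: V_def X_def)
    have "card V \<le> card Z"
      unfolding V_def X_def image_image using Z(1) by (rule card_image_le)
    then show "card V \<le> r" using Z(3) r by linarith
    show "V \<subseteq> cbox 0 1" using grid_round[OF n] X by (auto simp: V_def)
    show "\<exists>k::int. v $ i = real_of_int k / real n" if "v \<in> V" for v i
      using that by (auto simp: V_def grid_round_def)
    show "\<exists>p\<in>convex hull V. dist p c \<le> ?\<delta>\<^sup>2 + ?\<eta>" if "c \<in> C" for c
    proof -
      obtain p where p: "p \<in> convex hull X" "dist c p \<le> ?\<delta>\<^sup>2" using near[OF \<open>c \<in> C\<close>] by blast
      obtain q where q: "q \<in> convex hull V" "dist p q \<le> ?\<eta>"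
        using convex_hull_image_near[OF rnd p(1)] by (auto simp: V_def)
      have "dist q c \<le> ?\<delta>\<^sup>2 + ?\<eta>"
        using dist_triangle[of q c p] p(2) q(2) by (simp add: dist_commute)
      then show ?thesis using q(1) by blast
    qed
    show "\<exists>c\<in>C. dist c p \<le> ?\<delta>\<^sup>2 + ?\<eta>" if "p \<in> convex hull V" for p
    proof -
      have "\<forall>v\<in>V. \<exists>x. x \<in> X \<and> grid_round n x = v" by (auto simp: V_def)
      \<comment> \<open>\<open>h\<close> undoes the rounding by choosing an unrounded point of
        \<open>X\<close> for each vertex, so the same perturbation lemma leads from the hull of
        \<open>V\<close> back into \<open>C\<close>.\<close>
      then obtain h where h: "\<forall>v\<in>V. h v \<in> X \<and> grid_round n (h v) = v" by (rule bchoice[THEN exE])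
      have "\<exists>c\<in>convex hull (h ` V). dist p c \<le> ?\<eta>"
      proof (rule convex_hull_image_near[OF _ that])
        fix v assume "v \<in> V"
        then have "dist (h v) (grid_round n (h v)) \<le> ?\<eta>" "grid_round n (h v) = v"
          using h rnd by blast+
        then show "dist v (h v) \<le> ?\<eta>" by (simp add: dist_commute)
      qed
      moreover have "convex hull (h ` V) \<subseteq> C"
        using h X(1) C by (intro hull_minimal) auto
      ultimately obtain c where "c \<in> C" "dist p c \<le> ?\<eta>" by blast
      then show ?thesis by (intro bexI[of _ c]) (auto simp: dist_commute intro: add_increasing)
    qed
  qed
qed

text \<open>Passes from Hausdorff distance to volume. The volume bound asks for \<rho> \<le> 1/2;
  for larger \<rho> the claim is weaker than the trivial bound 1 for subsets of the cube.\<close>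

lemma grid_polytope_approximation:
  "\<exists>K>0. \<forall>C\<in>convex_bodies. \<forall>n>0. \<forall>m>0. \<forall>r.
     2 * CARD('d) * (m + 1) ^ (CARD('d) - 1) \<le> r \<longrightarrow> CARD('d) + 1 \<le> r \<longrightarrow>
     (\<exists>P\<in>grid_polytopes r n. measure lborel (sym_diff P (C :: (real ^ 'd::finite) set))
        \<le> K * (1 / (real m)\<^sup>2 + 1 / real n))"
proof -
  let ?D = "real CARD('d)"
  define L where "L = 4 * real DIM(real ^ 'd) * measure lborel (cball (0::real ^ 'd) (?D + DIM(real ^ 'd) + 4))"
  have L0: "0 \<le> L" unfolding L_def by simp
  \<comment> \<open>\<open>L\<close> converts distance to volume, the 2 makes
    \<open>(L + 2) * \<rho>\<close> exceed 1 once \<rho> > 1/2, \<open>9 * ?D\<^sup>2\<close>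
    dominates the coefficients of both terms of \<rho>, and the last 1 pays for the simplex of
    volume at most 1/n.\<close>
  define K where "K = (L + 2) * (9 * ?D\<^sup>2) + 1"
  have D1: "1 \<le> ?D" by (simp add: Suc_le_eq)
  have main: "\<exists>P\<in>grid_polytopes r n. measure lborel (sym_diff P C) \<le> K * (1 / (real m)\<^sup>2 + 1 / real n)"
    if C: "C \<in> convex_bodies" and n: "0 < n" and m: "0 < m"
      and r: "2 * CARD('d) * (m + 1) ^ (CARD('d) - 1) \<le> r" "CARD('d) + 1 \<le> r"
    for C :: "(real ^ 'd) set" and n m r
  proof -
    define \<rho> where "\<rho> = (3 * ?D / real m)\<^sup>2 + ?D / real n"
    have \<rho>0: "0 < \<rho>" unfolding \<rho>_def using n D1 by (intro add_nonneg_pos) auto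
    have "?D \<le> 9 * ?D\<^sup>2" using D1 self_le_power[of ?D 2] by linarith
    then have "?D / real n \<le> (9 * ?D\<^sup>2) * (1 / real n)"
      using divide_right_mono[of ?D "9 * ?D\<^sup>2" "real n"] by simp
    then have "\<rho> \<le> (9 * ?D\<^sup>2) * (1 / (real m)\<^sup>2) + (9 * ?D\<^sup>2) * (1 / real n)"
      unfolding \<rho>_def by (intro add_mono) (simp_all add: power_divide power_mult_distrib)
    then have "(L + 2) * \<rho> \<le> (L + 2) * ((9 * ?D\<^sup>2) * (1 / (real m)\<^sup>2 + 1 / real n))"
      using L0 by (intro mult_left_mono) (auto simp: distrib_left)
    moreover have "0 \<le> 1 / (real m)\<^sup>2" by simp
    moreover have "K * s = (L + 2) * ((9 * ?D\<^sup>2) * s) + s" for s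
      unfolding K_def by (simp only: distrib_right mult.assoc mult_1_left)
    ultimately have K: "(L + 2) * \<rho> + 1 / real n \<le> K * (1 / (real m)\<^sup>2 + 1 / real n)"
      by (smt (verit))
    have Cp: "compact C" "convex C" "C \<noteq> {}" "C \<subseteq> cbox 0 1"
      using C interior_subset by (auto simp: convex_bodies_def)
    obtain T :: "(real ^ 'd) set" where T: "T \<in> grid_polytopes r n" "measure lborel T \<le> 1 / real n"
      using small_simplex_grid_polytope[OF n r(2)] by blast
    note Tp = grid_polytopesD[OF T(1)]
    have Tm: "T \<in> fmeasurable lborel" "C \<in> fmeasurable lborel"
      using Tp Cp by (auto intro: fmeasurable_compact)
    have Tb: "T \<in> sets borel" "C \<in> sets borel"
      using Tp(1) Cp(1) by (auto intro: borel_compact)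
    show ?thesis
    proof (cases "\<rho> \<le> 1/2")
      case False
      have "measure lborel (sym_diff T C) \<le> 1"
        using Tp(3) Cp(4) Tb by (intro measure_subset_unit_cube_le_1) auto
      also have "1 \<le> (L + 2) * \<rho>"
        using False mult_nonneg_nonneg[OF L0 less_imp_le[OF \<rho>0]] unfolding distrib_right by linarith
      also have "\<dots> \<le> (L + 2) * \<rho> + 1 / real n" by simp
      also note K
      finally show ?thesis using T(1) by blast
    next
      case True
      from grid_polytope_near_convex_body[OF C n m r(1), folded \<rho>_def]
      obtain V :: "(real ^ 'd) set" where V: "finite V" "card V \<le> r" "V \<subseteq> cbox 0 1"
        "\<forall>v\<in>V. \<forall>i. \<exists>k::int. v $ i = real_of_int k / real n"
        "\<forall>c\<in>C. \<exists>p\<in>convex hull V. dist p c \<le> \<rho>"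
        "\<forall>p\<in>convex hull V. \<exists>c\<in>C. dist c p \<le> \<rho>"
        by (elim exE conjE)
      let ?P = "convex hull V"
      have P: "compact ?P" "convex ?P" "?P \<subseteq> cbox 0 1"
        using V(1,3) by (simp_all add: compact_convex_hull finite_imp_compact hull_minimal)
      have Pm: "?P \<in> fmeasurable lborel" and Pb: "?P \<in> sets borel"
        using P(1) by (auto intro: fmeasurable_compact borel_compact)
      have d: "measure lborel (sym_diff ?P C) \<le> L * \<rho>"
        unfolding L_def using P(3) Cp(4) unit_cube_subset_cball V(5,6)
        by (intro measure_sym_diff_le[OF P(1,2) _ Cp(1,2) _ \<rho>0 True]) blast+
      show ?thesis
      proof (cases "interior ?P = {}")
        case False
        then have "?P \<in> grid_polytopes r n"
          using V by (intro convex_hull_in_grid_polytopes) auto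
        moreover have "L * \<rho> \<le> (L + 2) * \<rho> + 1 / real n" using \<rho>0 by (simp add: distrib_right)
        ultimately show ?thesis using d K by (meson order_trans)
      next
        case True
        txt \<open>A flat hull is not in the class, but then \<open>C\<close> itself is small.\<close>
        then have "negligible ?P" using P by (simp add: negligible_convex_interior)
        then have "measure lebesgue ?P = 0" by (rule negligible_imp_measure0)
        then have "measure lborel ?P = 0" using P by (simp add: measure_completion borel_compact)
        moreover have "measure lborel C \<le> measure lborel (?P \<union> sym_diff ?P C)"
          using Pm Pb Tm Tb by (intro measure_mono_fmeasurable fmeasurable.Un) auto
        moreover have "\<dots> \<le> measure lborel ?P + measure lborel (sym_diff ?P C)"
          using Pm Pb Tm Tb by (intro measure_Un_le) auto
        ultimately have "measure lborel C \<le> L * \<rho>" using d by simp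
        moreover have "measure lborel (sym_diff T C) \<le> measure lborel (T \<union> C)"
          using Tm Tb by (intro measure_mono_fmeasurable fmeasurable.Un) auto
        moreover have "\<dots> \<le> measure lborel T + measure lborel C"
          using Tm Tb by (intro measure_Un_le) (auto intro: fmeasurableD)
        ultimately have "measure lborel (sym_diff T C) \<le> L * \<rho> + 1 / real n" using T(2) by simp
        also have "\<dots> \<le> (L + 2) * \<rho> + 1 / real n" using \<rho>0 by (simp add: distrib_right)
        also note K
        finally show ?thesis using T(1) by blast
      qed
    qed
  qed
  have "0 < K" unfolding K_def using L0 by (intro add_nonneg_pos) auto
  then show ?thesis using main by blast
qed

section \<open>The union bound\<close>

text \<open>A polytope is the hull of its vertices, which are among the (n+1)^d grid points of the
  cube, so lists of r grid points enumerate the class.\<close>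

lemma card_grid_polytopes_le:
  assumes n: "0 < n" and r: "0 < r"
  shows "finite (grid_polytopes r n :: (real ^ 'd::finite) set set)"
    "card (grid_polytopes r n :: (real ^ 'd::finite) set set) \<le> (n + 1) ^ (CARD('d) * r)"
proof -
  define B where "B = (\<lambda>k. real k / real n) ` {..n}"
  define \<Gamma> where "\<Gamma> = {x :: real ^ 'd. \<forall>i. x $ i \<in> B}"
  have B: "finite B" "card B \<le> n + 1"
    using card_image_le[of "{..n}" "\<lambda>k. real k / real n"] by (auto simp: B_def)
  have \<Gamma>: "finite \<Gamma>" "card \<Gamma> \<le> (n + 1) ^ CARD('d)"
  proof -
    show "finite \<Gamma>" unfolding \<Gamma>_def using B by (intro card_vec_set_le)
    have "card \<Gamma> \<le> (\<Prod>i\<in>(UNIV :: 'd set). card B)" unfolding \<Gamma>_def using B by (intro card_vec_set_le)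
    also have "\<dots> = card B ^ CARD('d)" by simp
    also have "\<dots> \<le> (n + 1) ^ CARD('d)" using B by (intro power_mono) auto
    finally show "card \<Gamma> \<le> (n + 1) ^ CARD('d)" .
  qed
  let ?L = "{l. set l \<subseteq> \<Gamma> \<and> length l = r}"
  have sub: "grid_polytopes r n \<subseteq> (\<lambda>l. convex hull (set l)) ` ?L"
  proof
    fix P :: "(real ^ 'd) set" assume P: "P \<in> grid_polytopes r n"
    define E where "E = {v. v extreme_point_of P}"
    have PE: "P = convex hull E"
      unfolding E_def using grid_polytopesD[OF P] by (intro Krein_Milman_Minkowski)
    have "P \<noteq> {}" using P by (auto simp: grid_polytopes_def)
    then have "E \<noteq> {}" using PE by auto
    \<comment> \<open>Finiteness of \<open>E\<close> comes from a finite generating set: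
      \<open>card\<close> is 0 on infinite sets, so the bound by r does not imply it.\<close>
    have "polytope P" using P by (simp add: grid_polytopes_def)
    then obtain V where V: "finite V" "P = convex hull V" unfolding polytope_def by blast
    have "E \<subseteq> V" unfolding E_def V(2) using extreme_point_of_convex_hull by blast
    then have fE: "finite E" using V(1) finite_subset by blast
    have "E \<subseteq> \<Gamma>"
    proof
      fix v assume v: "v \<in> E"
      then have "v \<in> P" by (auto simp: E_def extreme_point_of_def)
      then have vb: "0 \<le> v $ i" "v $ i \<le> 1" for i
        using grid_polytopesD(3)[OF P] by (auto simp: mem_box_cart)
      have "v $ i \<in> B" for i
      proof -
        obtain k :: int where k: "v $ i = real_of_int k / real n"
          using P v unfolding grid_polytopes_def E_def by blast
        have "0 \<le> k" "k \<le> int n" using vb[of i] n unfolding k by (auto simp: zero_le_divide_iff)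
        then have "v $ i = real (nat k) / real n" "nat k \<le> n" unfolding k by auto
        then show ?thesis unfolding B_def by blast
      qed
      then show "v \<in> \<Gamma>" by (simp add: \<Gamma>_def)
    qed
    obtain l where l: "set l = E" "distinct l" using finite_distinct_list[OF fE] by blast
    have len: "length l \<le> r" using distinct_card[OF l(2)] l(1) P by (simp add: grid_polytopes_def E_def)
    \<comment> \<open>Polytopes with fewer than r vertices are encoded by repeating the first vertex
      until the length is exactly r.\<close>
    have "l \<noteq> []" using l(1) \<open>E \<noteq> {}\<close> by auto
    then have "set (l @ replicate (r - length l) (hd l)) = E" using l(1) by (auto simp: set_replicate_conv_if)
    then have "P = convex hull (set (l @ replicate (r - length l) (hd l)))"
      "l @ replicate (r - length l) (hd l) \<in> ?L"
      using PE \<open>E \<subseteq> \<Gamma>\<close> len by auto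
    then show "P \<in> (\<lambda>l. convex hull (set l)) ` ?L" by blast
  qed
  have fL: "finite ?L" using \<Gamma>(1) by (rule finite_lists_length_eq)
  show "finite (grid_polytopes r n :: (real ^ 'd) set set)"
    using finite_subset[OF sub] fL by simp
  have "card (grid_polytopes r n :: (real ^ 'd) set set) \<le> card ((\<lambda>l. convex hull (set l)) ` ?L)"
    using sub fL by (intro card_mono) auto
  also have "\<dots> \<le> card ?L" using fL by (rule card_image_le)
  also have "\<dots> = card \<Gamma> ^ r" using \<Gamma>(1) by (rule card_lists_length_eq)
  also have "\<dots> \<le> ((n + 1) ^ CARD('d)) ^ r" using \<Gamma> by (intro power_mono) auto
  finally show "card (grid_polytopes r n :: (real ^ 'd) set set) \<le> (n + 1) ^ (CARD('d) * r)"
    by (simp add: power_mult)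
qed

section \<open>Exponential moments and the bound for a fixed candidate\<close>

text \<open>The law is a product of the design vector and the error vector, not of n pairs. Tonelli
  separates the vectors; the product formula then applies to the errors for a fixed design, and
  afterwards to the design.\<close>

lemma nn_integral_iid_pair_prod:
  fixes g :: "'a \<Rightarrow> 'b \<Rightarrow> ennreal"
  assumes U: "prob_space U" and N: "prob_space N"
    and g: "(\<lambda>(x, z). g x z) \<in> borel_measurable (U \<Otimes>\<^sub>M N)"
  shows "(\<integral>\<^sup>+ p. (\<Prod>i\<in>{..<n}. g (fst p i) (snd p i)) \<partial>((\<Pi>\<^sub>M i\<in>{..<n}. U) \<Otimes>\<^sub>M (\<Pi>\<^sub>M i\<in>{..<n}. N)))
    = (\<integral>\<^sup>+ x. \<integral>\<^sup>+ z. g x z \<partial>N \<partial>U) ^ n"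
proof -
  interpret U: prob_space U by fact
  interpret N: prob_space N by fact
  interpret UP: product_prob_space "\<lambda>i::nat. U" by unfold_locales
  interpret NP: product_prob_space "\<lambda>i::nat. N" by unfold_locales
  interpret NF: finite_product_prob_space "\<lambda>i::nat. N" "{..<n}" by unfold_locales auto
  have g1: "(\<lambda>x. \<integral>\<^sup>+ z. g x z \<partial>N) \<in> borel_measurable U"
    using g by (rule N.borel_measurable_nn_integral)
  have g2: "(\<lambda>p. g (fst p i) (snd p i)) \<in> borel_measurable ((\<Pi>\<^sub>M i\<in>{..<n}. U) \<Otimes>\<^sub>M (\<Pi>\<^sub>M i\<in>{..<n}. N))"
    if i: "i \<in> {..<n}" for i
  proof -
    have "(\<lambda>p. (fst p i, snd p i)) \<in> ((\<Pi>\<^sub>M i\<in>{..<n}. U) \<Otimes>\<^sub>M (\<Pi>\<^sub>M i\<in>{..<n}. N)) \<rightarrow>\<^sub>M U \<Otimes>\<^sub>M N"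
      using i by measurable
    from measurable_compose[OF this g] show ?thesis by simp
  qed
  have "(\<integral>\<^sup>+ p. (\<Prod>i\<in>{..<n}. g (fst p i) (snd p i)) \<partial>((\<Pi>\<^sub>M i\<in>{..<n}. U) \<Otimes>\<^sub>M (\<Pi>\<^sub>M i\<in>{..<n}. N)))
    = (\<integral>\<^sup>+ X. \<integral>\<^sup>+ Z. (\<Prod>i\<in>{..<n}. g (X i) (Z i)) \<partial>(\<Pi>\<^sub>M i\<in>{..<n}. N) \<partial>(\<Pi>\<^sub>M i\<in>{..<n}. U))"
    using NF.nn_integral_fst[of "\<lambda>p. \<Prod>i\<in>{..<n}. g (fst p i) (snd p i)" "\<Pi>\<^sub>M i\<in>{..<n}. U"] g2
    by (simp add: borel_measurable_prod_ennreal)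
  also have "\<dots> = (\<integral>\<^sup>+ X. (\<Prod>i\<in>{..<n}. \<integral>\<^sup>+ z. g (X i) z \<partial>N) \<partial>(\<Pi>\<^sub>M i\<in>{..<n}. U))"
  proof (intro nn_integral_cong NP.product_nn_integral_prod)
    fix X i assume X: "X \<in> space (\<Pi>\<^sub>M i\<in>{..<n}. U)" and i: "i \<in> {..<n}"
    then have "X i \<in> space U" by (auto simp: space_PiM)
    then have "(\<lambda>z. (X i, z)) \<in> N \<rightarrow>\<^sub>M U \<Otimes>\<^sub>M N" by simp
    from measurable_compose[OF this g] show "g (X i) \<in> borel_measurable N" by simp
  qed simp
  also have "\<dots> = (\<Prod>i\<in>{..<n}. \<integral>\<^sup>+ x. \<integral>\<^sup>+ z. g x z \<partial>N \<partial>U)"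
    using g1 by (intro UP.product_nn_integral_prod) auto
  finally show ?thesis by simp
qed

lemma emeasure_unit_cube: "emeasure lborel (cbox 0 1 :: (real ^ 'd::finite) set) = 1"
  using emeasure_eq_ennreal_measure[of lborel "cbox 0 1 :: (real ^ 'd) set"]
    fmeasurableD2[OF fmeasurable_compact[OF compact_cbox, of "0 :: real ^ 'd" 1]]
  by (simp add: measure_unit_cube)

lemma prob_space_uniform_cube: "prob_space (uniform_measure lborel (cbox 0 1 :: (real ^ 'd::finite) set))"
  by (rule prob_space_uniform_measure) (simp_all add: emeasure_unit_cube)

lemma measurable_sample:
  fixes G :: "(real ^ 'd::finite) set"
  assumes G: "G \<in> sets borel" and N: "sets N = sets borel"
  shows "(\<lambda>(X, \<xi>). \<lambda>i\<in>{..<n}. (X i, indicator G (X i) + \<xi> i :: real))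
    \<in> ((\<Pi>\<^sub>M i\<in>{..<n}. uniform_measure lborel (cbox 0 1)) \<Otimes>\<^sub>M (\<Pi>\<^sub>M i\<in>{..<n}. N)) \<rightarrow>\<^sub>M sample_space n"
  (is "?f \<in> ?M \<rightarrow>\<^sub>M _")
proof -
  have "(\<lambda>p. \<lambda>i\<in>{..<n}. (fst p i, indicator G (fst p i) + snd p i :: real)) \<in> ?M \<rightarrow>\<^sub>M sample_space n"
    unfolding sample_space_def
  proof (rule measurable_restrict)
    fix i assume i: "i \<in> {..<n}"
    have "(\<lambda>p. fst p i) \<in> ?M \<rightarrow>\<^sub>M uniform_measure lborel (cbox 0 1)"
      "(\<lambda>p. snd p i) \<in> ?M \<rightarrow>\<^sub>M N"
      using i by measurable
    then have [measurable]: "(\<lambda>p. fst p i) \<in> borel_measurable ?M" "(\<lambda>p. snd p i) \<in> borel_measurable ?M"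
      using N by (simp_all cong: measurable_cong_sets)
    note [measurable] = G
    show "(\<lambda>p. (fst p i, indicator G (fst p i) + snd p i)) \<in> ?M \<rightarrow>\<^sub>M borel"
      by measurable
  qed
  then show ?thesis by (simp add: case_prod_unfold)
qed

lemma subgaussian_exponential_moment:
  assumes "subgaussian \<sigma> N"
  shows "(\<integral>\<^sup>+ z. ennreal (exp (a + u * z)) \<partial>N) \<le> ennreal (exp (a + u\<^sup>2 * \<sigma>\<^sup>2 / 2))"
proof -
  have i: "integrable N (\<lambda>z. exp (u * z))" and le: "(LINT z|N. exp (u * z)) \<le> exp (u\<^sup>2 * \<sigma>\<^sup>2 / 2)"
    using assms by (auto simp: subgaussian_def)
  have "(\<integral>\<^sup>+ z. ennreal (exp (a + u * z)) \<partial>N) = ennreal (LINT z|N. exp a * exp (u * z))"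
    unfolding exp_add using i by (intro nn_integral_eq_integral integrable_mult_right) auto
  also have "\<dots> = ennreal (exp a * (LINT z|N. exp (u * z)))" by simp
  also have "\<dots> \<le> ennreal (exp a * exp (u\<^sup>2 * \<sigma>\<^sup>2 / 2))"
    using le by (intro ennreal_leI mult_left_mono) auto
  finally show ?thesis by (simp add: exp_add)
qed

text \<open>
  The choice \<open>\<theta> = 1 / (4\<sigma>\<^sup>2)\<close> makes the second order term of the noise equal to half of the drift.
\<close>

lemma prob_contrast_le:
  fixes C P Q :: "(real ^ 'd::finite) set" and \<sigma> :: real
  assumes \<sigma>: "0 < \<sigma>" and N: "prob_space N" "sets N = sets borel" "subgaussian \<sigma> N"
    and C: "C \<in> sets borel" "C \<subseteq> cbox 0 1" and P: "P \<in> sets borel" "P \<subseteq> cbox 0 1"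
    and Q: "Q \<in> sets borel" "Q \<subseteq> cbox 0 1"
  defines "\<theta> \<equiv> 1 / (4 * \<sigma>\<^sup>2)"
  defines "\<alpha> \<equiv> 1 - exp (- \<theta> / 2)" and "\<beta> \<equiv> exp (3 * \<theta> / 2) - 1"
  shows "{\<omega> \<in> space (sample_space n). contrast n \<omega> P \<le> contrast n \<omega> Q} \<in> sets (sample_space n)"
    "measure (sample_law N n C) {\<omega> \<in> space (sample_space n). contrast n \<omega> P \<le> contrast n \<omega> Q}
      \<le> exp (real n * ((\<alpha> + \<beta>) * measure lborel (sym_diff Q C) - \<alpha> * measure lborel (sym_diff P C)))"
proof -
  interpret N: prob_space N by fact
  let ?U = "uniform_measure lborel (cbox 0 1 :: (real ^ 'd) set)"
  interpret U: prob_space ?U by (rule prob_space_uniform_cube)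
  let ?M = "(\<Pi>\<^sub>M i\<in>{..<n}. ?U) \<Otimes>\<^sub>M (\<Pi>\<^sub>M i\<in>{..<n}. N)"
  let ?f = "\<lambda>(X, \<xi>). \<lambda>i\<in>{..<n}. (X i, indicator C (X i) + \<xi> i :: real)"
  let ?E = "{\<omega> \<in> space (sample_space n). contrast n \<omega> P \<le> contrast n \<omega> Q}"
  note [measurable] = C(1) P(1) Q(1)
  have mf: "?f \<in> ?M \<rightarrow>\<^sub>M sample_space n" by (rule measurable_sample[OF C(1) N(2)])
  have [measurable]: "fst \<in> borel_measurable (borel :: ((real ^ 'd) \<times> real) measure)"
    "snd \<in> borel_measurable (borel :: ((real ^ 'd) \<times> real) measure)"
    by (simp_all add: borel_measurable_continuous_onI continuous_on_fst continuous_on_snd continuous_on_id)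
  have mc [measurable]: "(\<lambda>\<omega>. contrast n \<omega> A) \<in> borel_measurable (sample_space n)"
    if [measurable]: "A \<in> sets borel" for A :: "(real ^ 'd) set"
    unfolding contrast_def sample_space_def by measurable
  show E: "?E \<in> sets (sample_space n)" by measurable
  define D where "D x = indicator P x - (indicator Q x :: real)" for x :: "real ^ 'd"
  \<comment> \<open>The factor that one observation contributes to the exponential of \<theta> times
    the contrast of \<open>Q\<close> minus that of \<open>P\<close>, written with
    \<open>1 - 2 * Y\<close> split into its design part and the noise.\<close>
  define g where "g x z = ennreal (exp (- \<theta> * (1 - 2 * indicator C x) * D x + 2 * \<theta> * D x * z))" for x z
  have gm: "(\<lambda>(x, z). g x z) \<in> borel_measurable (?U \<Otimes>\<^sub>M N)"
  proof -
    have [measurable]: "(\<lambda>p. snd p) \<in> borel_measurable (?U \<Otimes>\<^sub>M N)"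
      using N(2) measurable_snd[of ?U N] by (simp cong: measurable_cong_sets)
    have [measurable]: "(\<lambda>p. fst p) \<in> borel_measurable (?U \<Otimes>\<^sub>M N)"
      using measurable_fst[of ?U N] by (simp cong: measurable_cong_sets)
    show ?thesis unfolding g_def D_def case_prod_unfold by measurable
  qed
  have lam: "0 < \<theta>" "2 * \<theta>\<^sup>2 * \<sigma>\<^sup>2 = \<theta> / 2"
    using \<sigma> by (simp_all add: \<theta>_def power2_eq_square field_simps)
  have ab: "0 \<le> \<alpha>" "0 \<le> \<beta>" using lam by (auto simp: \<alpha>_def \<beta>_def)
  \<comment> \<open>Once the noise is integrated out, the exponent is at most -\<theta> + \<theta>/2
    where only \<open>P\<close> disagrees with \<open>C\<close>, \<theta> + \<theta>/2 where only
    \<open>Q\<close> does, and 0 elsewhere. The exponentials are 1 - \<alpha>, 1 + \<beta> and 1;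
    the extra \<alpha> in the last coefficient keeps \<open>h\<close> above 1 where both
    disagree.\<close>
  define h where "h x = 1 - \<alpha> * indicator (sym_diff P C) x + (\<alpha> + \<beta>) * indicator (sym_diff Q C) x" for x
  have inner: "(\<integral>\<^sup>+ z. g x z \<partial>N) \<le> ennreal (h x)" for x
  proof -
    have "(\<integral>\<^sup>+ z. g x z \<partial>N) \<le>
        ennreal (exp (- \<theta> * (1 - 2 * indicator C x) * D x + (2 * \<theta> * D x)\<^sup>2 * \<sigma>\<^sup>2 / 2))"
      unfolding g_def by (rule subgaussian_exponential_moment[OF N(3)])
    also have "(2 * \<theta> * D x)\<^sup>2 * \<sigma>\<^sup>2 / 2 = (2 * \<theta>\<^sup>2 * \<sigma>\<^sup>2) * (D x)\<^sup>2" by (simp add: power_mult_distrib)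
    also have "\<dots> = \<theta> / 2 * (D x)\<^sup>2" by (simp only: lam)
    also have "exp (- \<theta> * (1 - 2 * indicator C x) * D x + \<theta> / 2 * (D x)\<^sup>2) \<le> h x"
      using ab lam(1) unfolding h_def D_def
      by (cases "x \<in> C"; cases "x \<in> P"; cases "x \<in> Q") (auto simp: \<alpha>_def \<beta>_def)
    finally show ?thesis by (simp add: ennreal_leI)
  qed
  have Um: "measure ?U A = measure lborel A" if "A \<in> sets borel" "A \<subseteq> cbox 0 1" for A
    using that measure_uniform_measure[of lborel "cbox 0 1" A]
    by (simp add: measure_unit_cube Int_absorb1 emeasure_unit_cube)
  have hi: "integrable ?U h" "(LINT x|?U. h x)
      = 1 - \<alpha> * measure lborel (sym_diff P C) + (\<alpha> + \<beta>) * measure lborel (sym_diff Q C)"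
  proof -
    have s: "sym_diff P C \<in> sets borel" "sym_diff Q C \<in> sets borel"
      "sym_diff P C \<subseteq> cbox 0 1" "sym_diff Q C \<subseteq> cbox 0 1"
      using C P Q by auto
    have i: "integrable ?U (indicator (sym_diff P C) :: _ \<Rightarrow> real)"
      "integrable ?U (indicator (sym_diff Q C) :: _ \<Rightarrow> real)"
      using s by (auto intro!: integrable_real_indicator simp: U.emeasure_eq_measure)
    then show "integrable ?U h" unfolding h_def by simp
    show "(LINT x|?U. h x)
      = 1 - \<alpha> * measure lborel (sym_diff P C) + (\<alpha> + \<beta>) * measure lborel (sym_diff Q C)"
      unfolding h_def using i s using U.prob_space by (simp add: Um)
  qed
  have h0: "0 \<le> h x" for x
    using ab by (auto simp: h_def \<alpha>_def split: split_indicator)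
  let ?B = "(\<alpha> + \<beta>) * measure lborel (sym_diff Q C) - \<alpha> * measure lborel (sym_diff P C)"
  have outer: "(\<integral>\<^sup>+ x. \<integral>\<^sup>+ z. g x z \<partial>N \<partial>?U) \<le> ennreal (exp ?B)"
  proof -
    have "(\<integral>\<^sup>+ x. \<integral>\<^sup>+ z. g x z \<partial>N \<partial>?U) \<le> (\<integral>\<^sup>+ x. ennreal (h x) \<partial>?U)"
      by (intro nn_integral_mono inner)
    also have "\<dots> = ennreal (LINT x|?U. h x)"
      using hi(1) h0 by (intro nn_integral_eq_integral) auto
    \<comment> \<open>By 1 + y \<le> exp y, so that the n-th power becomes a factor n in the
      exponent.\<close>
    also have "\<dots> \<le> ennreal (exp ?B)"
      unfolding hi(2) using exp_ge_add_one_self[of ?B] by (intro ennreal_leI) linarith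
    finally show ?thesis .
  qed
  have "emeasure (sample_law N n C) ?E = emeasure ?M (?f -` ?E \<inter> space ?M)"
    unfolding sample_law_def using mf E by (rule emeasure_distr)
  also have "\<dots> = (\<integral>\<^sup>+ p. indicator (?f -` ?E \<inter> space ?M) p \<partial>?M)"
    using measurable_sets[OF mf E] by simp
  \<comment> \<open>The exponential Markov inequality: on the event the contrast difference is
    nonnegative, so the product is at least 1.\<close>
  also have "\<dots> \<le> (\<integral>\<^sup>+ p. (\<Prod>i\<in>{..<n}. g (fst p i) (snd p i)) \<partial>?M)"
  proof (rule nn_integral_mono)
    fix p assume p: "p \<in> space ?M"
    show "indicator (?f -` ?E \<inter> space ?M) p \<le> (\<Prod>i\<in>{..<n}. g (fst p i) (snd p i))"
    proof (cases "?f p \<in> ?E")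
      case True
      have eq: "(\<Sum>i<n. - \<theta> * (1 - 2 * indicator C (fst p i)) * D (fst p i) + 2 * \<theta> * D (fst p i) * snd p i)
          = \<theta> * (contrast n (?f p) Q - contrast n (?f p) P)"
        unfolding contrast_def sum_subtractf[symmetric] sum_distrib_left
        by (intro sum.cong) (auto simp: D_def case_prod_unfold algebra_simps)
      have "0 \<le> \<theta> * (contrast n (?f p) Q - contrast n (?f p) P)"
        using True lam(1) by simp
      then have "1 \<le> exp (\<Sum>i<n. - \<theta> * (1 - 2 * indicator C (fst p i)) * D (fst p i) + 2 * \<theta> * D (fst p i) * snd p i)"
        unfolding eq by simp
      then have "1 \<le> (\<Prod>i\<in>{..<n}. g (fst p i) (snd p i))"
        unfolding g_def by (simp add: prod_ennreal exp_sum)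
      then show ?thesis by (simp add: indicator_def)
    next
      case False
      then have "p \<notin> ?f -` ?E \<inter> space ?M" by blast
      then show ?thesis by simp
    qed
  qed
  also have "\<dots> = (\<integral>\<^sup>+ x. \<integral>\<^sup>+ z. g x z \<partial>N \<partial>?U) ^ n"
    by (rule nn_integral_iid_pair_prod[OF U.prob_space_axioms N(1) gm])
  also have "\<dots> \<le> ennreal (exp ?B) ^ n" by (intro power_mono outer) simp
  also have "\<dots> = ennreal (exp (real n * ?B))" by (simp add: ennreal_power exp_of_nat_mult)
  finally show "measure (sample_law N n C) ?E \<le> exp (real n * ?B)"
    by (simp add: measure_def enn2real_leI)
qed

section \<open>Balancing the rates\<close>

text \<open>Here q is the target rate and a is r before taking the floor; both are powers of t = ln
  n / n. The third claim equates the entropy term r ln n with n q, the fourth equates the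
  approximation error of order \<open>a powr (- 2 / (D - 1))\<close> with q.\<close>

lemma minimax_rate_facts:
  fixes D n :: nat
  assumes D: "2 \<le> D" and n: "2 \<le> n"
  defines "q \<equiv> (ln (real n) / real n) powr (2 / (real D + 1))"
  defines "a \<equiv> (real n / ln (real n)) powr ((real D - 1) / (real D + 1))"
  shows "0 < q" "1 / real n \<le> 2 * q" "a * ln (real n) = real n * q"
    "(a powr (1 / (real D - 1)))\<^sup>2 * q = 1" "0 < a"
proof -
  define t where "t = ln (real n) / real n"
  have l: "1 / 2 \<le> ln (real n)"
  proof -
    have "ln 2 \<le> ln (real n)" using n by simp
    then show ?thesis using ln2_ge_two_thirds by linarith
  qed
  have t: "0 < t" "t \<le> 1" "1 / real n \<le> 2 * t" "t = ln (real n) / real n"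
  proof -
    show "0 < t" unfolding t_def using l n by simp
    show "t \<le> 1" unfolding t_def using n ln_le_minus_one[of "real n"] by simp
    have "1 \<le> 2 * ln (real n)" using l by simp
    then show "1 / real n \<le> 2 * t" unfolding t_def using n by (simp add: divide_right_mono)
  qed (rule t_def)
  have q: "q = t powr (2 / (real D + 1))" by (simp add: q_def t_def)
  show "0 < q" unfolding q using t(1) by simp
  have it: "real n / ln (real n) = t powr (-1)" using t(1)
  proof -
    have "t powr (-1) = 1 / t" using t(1) by (simp add: powr_minus_divide)
    also have "\<dots> = real n / ln (real n)" by (simp add: t_def)
    finally show ?thesis ..
  qed
  have a: "a = t powr (- ((real D - 1) / (real D + 1)))"
    unfolding a_def it powr_powr by (simp only: mult_minus1)
  show "0 < a" unfolding a using t(1) by simp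
  have t1: "t powr 1 = t" using t(1) by simp
  have nt: "real n * t = ln (real n)" using n by (simp add: t_def)
  have "t powr 1 \<le> q" unfolding q using t D by (intro powr_mono') auto
  then show "1 / real n \<le> 2 * q" using t(3) t1 by linarith
  have "a * ln (real n) = real n * (a * t powr 1)"
    unfolding t1 nt[symmetric] by (rule mult.left_commute)
  also have "a * t powr 1 = q"
    unfolding a q powr_add[symmetric] by (rule arg_cong[where f="\<lambda>e. t powr e"]) (simp add: field_simps)
  finally show "a * ln (real n) = real n * q" .
  have "(a powr (1 / (real D - 1)))\<^sup>2 = t powr (- (2 / (real D + 1)))"
  proof -
    have e: "(real D - 1) / (real D + 1) * (1 / (real D - 1)) = 1 / (real D + 1)" using D by simp
    have "(a powr (1 / (real D - 1)))\<^sup>2 = a powr (1 / (real D - 1)) * a powr (1 / (real D - 1))"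
      by (simp add: power2_eq_square)
    also have "\<dots> = t powr (- (2 / (real D + 1)))"
      unfolding a powr_powr powr_add[symmetric] minus_mult_left[symmetric] e by simp
    finally show ?thesis .
  qed
  then show "(a powr (1 / (real D - 1)))\<^sup>2 * q = 1"
    unfolding q using t(1) by (simp add: powr_add[symmetric])
qed

text \<open>The vertex budget allows m of order (r / (2d))^(1/(d-1)), which makes 1/m^2 of order q.
  If r is too small for this choice, q is bounded below and any candidate will do.\<close>

lemma grid_polytope_approximation_rate:
  assumes D: "2 \<le> CARD('d::finite)"
  shows "\<exists>K>0. \<forall>C\<in>convex_bodies. \<forall>n\<ge>2. CARD('d) + 1 \<le> num_vertices CARD('d) n \<longrightarrow>
     (\<exists>P\<in>grid_polytopes (num_vertices CARD('d) n) n. measure lborel (sym_diff P (C :: (real ^ 'd) set))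
        \<le> K * (ln (real n) / real n) powr (2 / (real CARD('d) + 1)))"
proof -
  let ?D = "real CARD('d)"
  obtain K where K: "0 < K" and approx: "\<And>C n m r. C \<in> convex_bodies \<Longrightarrow> 0 < n \<Longrightarrow> 0 < m \<Longrightarrow>
     2 * CARD('d) * (m + 1) ^ (CARD('d) - 1) \<le> r \<Longrightarrow> CARD('d) + 1 \<le> r \<Longrightarrow>
     \<exists>P\<in>grid_polytopes r n. measure lborel (sym_diff P (C :: (real ^ 'd) set))
        \<le> K * (1 / (real m)\<^sup>2 + 1 / real n)"
    using grid_polytope_approximation[where 'd='d] by metis
  \<comment> \<open>The first summand serves large r, where 1/m^2 \<le> 256 d^2 q and 1/n \<le> 2 q;
    the second serves small r, where 1 \<le> 64 d^2 q.\<close>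
  define K' where "K' = K * (256 * ?D\<^sup>2 + 2) + 64 * ?D\<^sup>2"
  have "0 < K'" unfolding K'_def using K by (intro add_pos_nonneg mult_pos_pos add_nonneg_pos) auto
  moreover have "\<exists>P\<in>grid_polytopes r n. measure lborel (sym_diff P (C :: (real ^ 'd) set))
        \<le> K' * (ln (real n) / real n) powr (2 / (?D + 1))"
    if C: "C \<in> convex_bodies" and n: "2 \<le> n" and r: "r = num_vertices CARD('d) n" "CARD('d) + 1 \<le> r"
    for C :: "(real ^ 'd) set" and n r
  proof -
    define q where "q = (ln (real n) / real n) powr (2 / (?D + 1))"
    define a where "a = (real n / ln (real n)) powr ((?D - 1) / (?D + 1))"
    define e where "e = 1 / (?D - 1)"
    define s where "s = a powr e"
    note qa = minimax_rate_facts[OF D n, folded q_def a_def]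
    have s: "0 < s" "s\<^sup>2 * q = 1" using qa unfolding s_def e_def by auto
    have e: "0 < e" "e \<le> 1" unfolding e_def using D by auto
    \<comment> \<open>The real solution of \<open>2 * ?D * y ^ (CARD('d) - 1) = r\<close>, an upper
      limit for m + 1.\<close>
    define y where "y = (real r / (2 * ?D)) powr e"
    \<comment> \<open>Because r \<ge> 1, taking the floor loses at most a factor of 2.\<close>
    have "a < real r + 1" "1 \<le> r"
      using r unfolding num_vertices_def a_def[symmetric] by linarith+
    then have ar: "a \<le> 2 * real r" by simp
    have sy: "s \<le> 4 * ?D * y"
    proof -
      have "s \<le> (4 * ?D * (real r / (2 * ?D))) powr e"
        unfolding s_def using ar qa(5) e by (intro powr_mono2) auto
      also have "\<dots> = (4 * ?D) powr e * y" unfolding y_def by (intro powr_mult)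
      also have "\<dots> \<le> (4 * ?D) powr 1 * y"
        using e by (intro mult_right_mono powr_mono) (auto simp: y_def Suc_le_eq intro: order_trans[of _ "?D"])
      finally show ?thesis by simp
    qed
    have final: ?thesis if "\<exists>P\<in>grid_polytopes r n. measure lborel (sym_diff P C) \<le> M * q" "M \<le> K'" for M
      using that qa(1) mult_right_mono[OF that(2), of q] unfolding q_def[symmetric]
      by (meson less_imp_le order_trans)
    show ?thesis
    proof (cases "2 \<le> y")
      case False
      have "4 * ?D * y \<le> 4 * ?D * 2" using False by (intro mult_left_mono) auto
      then have "s \<le> 8 * ?D" using sy by linarith
      then have "s\<^sup>2 \<le> (8 * ?D)\<^sup>2" using s by (intro power_mono) auto
      then have "s\<^sup>2 * q \<le> (8 * ?D)\<^sup>2 * q" using qa(1) by (intro mult_right_mono) auto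
      then have 1: "1 \<le> (64 * ?D\<^sup>2) * q" using s by (simp add: power_mult_distrib)
      obtain T :: "(real ^ 'd) set" where T: "T \<in> grid_polytopes r n"
        using small_simplex_grid_polytope[of n r, where 'd='d] n r(2) by auto
      have "C \<subseteq> cbox 0 1" "C \<in> sets borel" "T \<subseteq> cbox 0 1" "T \<in> sets borel"
        using C grid_polytopesD[OF T] by (auto simp: convex_bodies_def borel_compact)
      then have "measure lborel (sym_diff T C) \<le> 1" by (intro measure_subset_unit_cube_le_1) auto
      then show ?thesis using T 1 K
        by (intro final[of "64 * ?D\<^sup>2"]) (auto simp: K'_def intro: order_trans)
    next
      case True
      \<comment> \<open>Subtracting 1 gives m + 1 \<le> y, and y \<ge> 2 keeps m positive and
        comparable to y.\<close>
      define m where "m = nat \<lfloor>y\<rfloor> - 1"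
      have m: "0 < m" "real m + 1 \<le> y" "y \<le> 4 * real m"
      proof -
        have "2 \<le> nat \<lfloor>y\<rfloor>" using True by linarith
        moreover from this have "real m = real (nat \<lfloor>y\<rfloor>) - 1"
          unfolding m_def by (simp only: of_nat_diff)
        moreover have "real (nat \<lfloor>y\<rfloor>) \<le> y" "y < real (nat \<lfloor>y\<rfloor>) + 1" using True by linarith+
        ultimately show "0 < m" "real m + 1 \<le> y" "y \<le> 4 * real m"
          by linarith+
      qed
      have "(real m + 1) ^ (CARD('d) - 1) \<le> y ^ (CARD('d) - 1)"
        using m by (intro power_mono) auto
      also have "\<dots> = real r / (2 * ?D)"

      proof -
        have "y ^ (CARD('d) - 1) = y powr (?D - 1)"
          using True D by (simp add: powr_realpow[symmetric] of_nat_diff)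
        also have "\<dots> = (real r / (2 * ?D)) powr 1"
          unfolding y_def powr_powr e_def using D by simp
        finally show ?thesis by simp
      qed
      finally have "2 * ?D * (real m + 1) ^ (CARD('d) - 1) \<le> real r"
        by (simp add: field_simps)
      then have "real (2 * CARD('d) * (m + 1) ^ (CARD('d) - 1)) \<le> real r" by (simp add: add.commute)
      then have "2 * CARD('d) * (m + 1) ^ (CARD('d) - 1) \<le> r" by (simp only: of_nat_le_iff)
      from approx[OF C _ m(1) this r(2), of n]
      obtain P where P: "P \<in> grid_polytopes r n"
        "measure lborel (sym_diff P C) \<le> K * (1 / (real m)\<^sup>2 + 1 / real n)" using n by auto
      have "4 * ?D * y \<le> 4 * ?D * (4 * real m)" using m(3) by (intro mult_left_mono) auto
      then have "s \<le> 16 * ?D * real m" using sy by linarith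
      then have "s\<^sup>2 \<le> (16 * ?D * real m)\<^sup>2" using s by (intro power_mono) auto
      then have "s\<^sup>2 * q \<le> (16 * ?D * real m)\<^sup>2 * q" using qa(1) by (intro mult_right_mono) auto
      then have "1 \<le> 256 * ?D\<^sup>2 * q * (real m)\<^sup>2" using s by (simp add: power_mult_distrib ac_simps)
      then have "1 / (real m)\<^sup>2 \<le> 256 * ?D\<^sup>2 * q" using m(1) by (simp add: pos_divide_le_eq)
      then have "1 / (real m)\<^sup>2 + 1 / real n \<le> (256 * ?D\<^sup>2 + 2) * q"
        using qa(2) by (simp add: distrib_right)
      then have "K * (1 / (real m)\<^sup>2 + 1 / real n) \<le> K * ((256 * ?D\<^sup>2 + 2) * q)"
        using K by (intro mult_left_mono) auto
      then show ?thesis using P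
        by (intro final[of "K * (256 * ?D\<^sup>2 + 2)"]) (auto simp: K'_def mult.assoc intro!: bexI[of _ P])
    qed
  qed
  ultimately show ?thesis by blast
qed

section \<open>The deviation inequality\<close>

theorem theorem3:
  fixes \<sigma> :: real
  assumes "CARD('d::finite) \<ge> 2" and "\<sigma> > 0"
  shows "\<exists>C1>0. \<exists>C2>0. \<exists>C3>0.
    \<forall>n\<ge>2. \<forall>r. \<forall>N :: real measure. \<forall>Phat :: (nat \<Rightarrow> (real ^ 'd) \<times> real) \<Rightarrow> (real ^ 'd) set.
      r = num_vertices CARD('d) n \<longrightarrow> r \<ge> CARD('d) + 1 \<longrightarrow>
      prob_space N \<longrightarrow> sets N = sets borel \<longrightarrow> subgaussian \<sigma> N \<longrightarrow>
      is_estimator r n Phat \<longrightarrow>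
      (\<forall>x>0. (SUP C\<in>convex_bodies. measure (sample_law N n C)
          {\<omega> \<in> space (sample_law N n C).
             real n * (measure lborel (sym_diff (Phat \<omega>) C)
                - (C3 * ln (real n) / real n) powr (2 / (real CARD('d) + 1))) \<ge> x})
        \<le> C1 * exp (- C2 * x))"
proof -
  let ?D = "real CARD('d)"
  define \<theta> where "\<theta> = 1 / (4 * \<sigma>\<^sup>2)"
  define \<alpha> where "\<alpha> = 1 - exp (- \<theta> / 2)"
  define \<beta> where "\<beta> = exp (3 * \<theta> / 2) - 1"
  have \<theta>: "0 < \<theta>" using assms(2) by (simp add: \<theta>_def)
  have \<alpha>: "0 < \<alpha>" and \<beta>: "0 < \<beta>" using \<theta> by (auto simp: \<alpha>_def \<beta>_def)
  obtain K where K: "0 < K" and approx: "\<And>C n. C \<in> convex_bodies \<Longrightarrow> 2 \<le> n \<Longrightarrow>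
     CARD('d) + 1 \<le> num_vertices CARD('d) n \<Longrightarrow>
     \<exists>P\<in>grid_polytopes (num_vertices CARD('d) n) n. measure lborel (sym_diff P (C :: (real ^ 'd) set))
        \<le> K * (ln (real n) / real n) powr (2 / (?D + 1))"
    using grid_polytope_approximation_rate[OF assms(1)] by metis
  \<comment> \<open>Chosen so that \<open>\<alpha> * L = 2 * ?D + (\<alpha> + \<beta>) * K\<close>:
    the second term absorbs the approximation error of \<open>Q\<close>, the first the number of
    candidates. \<alpha> and \<beta> depend on \<sigma> only, K on the dimension only.\<close>
  define L where "L = (2 * ?D + (\<alpha> + \<beta>) * K) / \<alpha>"
  have L: "0 < L" unfolding L_def using K \<alpha> \<beta> by (intro divide_pos_pos add_nonneg_pos mult_pos_pos) auto
  \<comment> \<open>The exponent is the inverse of 2/(d+1), so that the threshold in the statement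
    becomes L q.\<close>
  define C3 where "C3 = L powr ((?D + 1) / 2)"
  have C3: "0 < C3" using L by (simp add: C3_def)
  have main: "measure (sample_law N n C) {\<omega> \<in> space (sample_law N n C).
         x \<le> real n * (measure lborel (sym_diff (Phat \<omega>) C)
            - (C3 * ln (real n) / real n) powr (2 / (?D + 1)))} \<le> exp (- \<alpha> * x)"
    if n: "2 \<le> n" and r: "r = num_vertices CARD('d) n" "CARD('d) + 1 \<le> r"
      and N: "prob_space N" "sets N = sets borel" "subgaussian \<sigma> N"
      and est: "is_estimator r n Phat" and C: "C \<in> convex_bodies"
    for n r N x and Phat :: "(nat \<Rightarrow> (real ^ 'd) \<times> real) \<Rightarrow> (real ^ 'd) set" and C
  proof -
    define q where "q = (ln (real n) / real n) powr (2 / (?D + 1))"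
    note qa = minimax_rate_facts[OF assms(1) n, folded q_def]
    have tau: "(C3 * ln (real n) / real n) powr (2 / (?D + 1)) = L * q"
    proof -
      have "(C3 * (ln (real n) / real n)) powr (2 / (?D + 1)) = C3 powr (2 / (?D + 1)) * q"
        unfolding q_def by (rule powr_mult)
      also have "C3 powr (2 / (?D + 1)) = L powr 1"
        unfolding C3_def powr_powr by (rule arg_cong[where f="\<lambda>e. L powr e"]) (simp add: divide_simps)
      also have "\<dots> = L" using L by simp
      finally show ?thesis by simp
    qed
    obtain Q where Q: "Q \<in> grid_polytopes r n" "measure lborel (sym_diff Q C) \<le> K * q"
      using approx[OF C n] r by (auto simp: q_def)
    have Cp: "C \<in> sets borel" "C \<subseteq> cbox 0 1"
      using C by (auto simp: convex_bodies_def borel_compact)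
    have gp: "P \<in> sets borel" "P \<subseteq> cbox 0 1" if "P \<in> grid_polytopes r n" for P :: "(real ^ 'd) set"
      using grid_polytopesD[OF that] by (auto intro: borel_compact)
    let ?E = "\<lambda>P. {\<omega> \<in> space (sample_space n). contrast n \<omega> P \<le> contrast n \<omega> Q}"
    \<comment> \<open>The candidates that are too far from \<open>C\<close>: the deviation event
      says that the estimator takes a value in \<open>F\<close>, and each such value has to beat
      \<open>Q\<close>.\<close>
    define F where "F = {P \<in> grid_polytopes r n. L * q + x / real n \<le> measure lborel (sym_diff P C)}"
    have card: "finite (grid_polytopes r n :: (real ^ 'd) set set)"
      "card (grid_polytopes r n :: (real ^ 'd) set set) \<le> (n + 1) ^ (CARD('d) * r)"
      using card_grid_polytopes_le[of n r, where 'd='d] n r by auto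
    have F: "finite F" "card F \<le> (n + 1) ^ (CARD('d) * r)" "F \<subseteq> grid_polytopes r n"
      using card card_mono[OF card(1), of F] by (auto simp: F_def)
    have sp: "space (sample_law N n C) = space (sample_space n)"
      "sets (sample_law N n C) = sets (sample_space n)"
      by (simp_all add: sample_law_def)
    interpret prob_space "sample_law N n C"
    proof -
      interpret N: prob_space N by fact
      interpret U: prob_space "uniform_measure lborel (cbox 0 1 :: (real ^ 'd) set)"
        by (rule prob_space_uniform_cube)
      interpret UF: prob_space "\<Pi>\<^sub>M i\<in>{..<n}. uniform_measure lborel (cbox 0 1 :: (real ^ 'd) set)"
        by (intro prob_space_PiM U.prob_space_axioms)
      interpret NF: prob_space "\<Pi>\<^sub>M i\<in>{..<n}. N"
        by (intro prob_space_PiM N.prob_space_axioms)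
      interpret pair_prob_space "\<Pi>\<^sub>M i\<in>{..<n}. uniform_measure lborel (cbox 0 1 :: (real ^ 'd) set)"
        "\<Pi>\<^sub>M i\<in>{..<n}. N" ..
      show "prob_space (sample_law N n C)"
        unfolding sample_law_def by (intro prob_space_distr measurable_sample Cp N)
    qed
    have sub: "{\<omega> \<in> space (sample_law N n C).
         x \<le> real n * (measure lborel (sym_diff (Phat \<omega>) C)
            - (C3 * ln (real n) / real n) powr (2 / (?D + 1)))} \<subseteq> (\<Union>P\<in>F. ?E P)"
    proof
      fix \<omega> assume w: "\<omega> \<in> {\<omega> \<in> space (sample_law N n C).
         x \<le> real n * (measure lborel (sym_diff (Phat \<omega>) C)
            - (C3 * ln (real n) / real n) powr (2 / (?D + 1)))}"
      then have ws: "\<omega> \<in> space (sample_space n)" by (simp add: sp)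
      then have am: "is_arg_min (contrast n \<omega>) (\<lambda>P. P \<in> grid_polytopes r n) (Phat \<omega>)"
        using est by (auto simp: is_estimator_def)
      then have "contrast n \<omega> (Phat \<omega>) \<le> contrast n \<omega> Q"
        using Q(1) by (auto simp: is_arg_min_def not_less)
      moreover have "Phat \<omega> \<in> F"
        using w am n unfolding F_def tau by (auto simp: is_arg_min_def field_simps)
      ultimately show "\<omega> \<in> (\<Union>P\<in>F. ?E P)" using ws by blast
    qed
    have Es: "?E P \<in> sets (sample_law N n C)"
      and Eb: "prob (?E P) \<le> exp (real n * ((\<alpha> + \<beta>) * (K * q) - \<alpha> * (L * q + x / real n)))"
      if P: "P \<in> F" for P
    proof -
      have P': "P \<in> grid_polytopes r n" using P F by blast
      note b = prob_contrast_le[OF assms(2) N Cp gp[OF P'] gp[OF Q(1)], of n,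
          folded \<theta>_def, folded \<alpha>_def \<beta>_def]
      show "?E P \<in> sets (sample_law N n C)" using b(1) by (simp add: sp)
      have "(\<alpha> + \<beta>) * measure lborel (sym_diff Q C) \<le> (\<alpha> + \<beta>) * (K * q)"
        using Q(2) \<alpha> \<beta> by (intro mult_left_mono) auto
      moreover have "\<alpha> * (L * q + x / real n) \<le> \<alpha> * measure lborel (sym_diff P C)"
        using P \<alpha> by (intro mult_left_mono) (auto simp: F_def)
      ultimately have "(\<alpha> + \<beta>) * measure lborel (sym_diff Q C) - \<alpha> * measure lborel (sym_diff P C)
          \<le> (\<alpha> + \<beta>) * (K * q) - \<alpha> * (L * q + x / real n)" by linarith
      then have "real n * ((\<alpha> + \<beta>) * measure lborel (sym_diff Q C) - \<alpha> * measure lborel (sym_diff P C))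
          \<le> real n * ((\<alpha> + \<beta>) * (K * q) - \<alpha> * (L * q + x / real n))"
        by (rule mult_left_mono) simp
      then show "prob (?E P) \<le> exp (real n * ((\<alpha> + \<beta>) * (K * q) - \<alpha> * (L * q + x / real n)))"
        using b(2) exp_le_cancel_iff order_trans by blast
    qed
    have ex: "real n * ((\<alpha> + \<beta>) * (K * q) - \<alpha> * (L * q + x / real n)) = - (2 * ?D * (real n * q)) - \<alpha> * x"
    proof -
      have "\<alpha> * L = 2 * ?D + (\<alpha> + \<beta>) * K" unfolding L_def using \<alpha> by simp
      then have "\<alpha> * (L * q + x / real n) = (2 * ?D + (\<alpha> + \<beta>) * K) * q + \<alpha> * x / real n"
        by (simp add: distrib_left mult.assoc[symmetric])
      then show ?thesis using n by (simp add: field_simps)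
    qed
    \<comment> \<open>As n \<ge> 2 gives n + 1 \<le> n^2, the logarithm of the cardinality is at
      most 2 d r ln n, and r ln n \<le> n q by the choice of r. This is what the first exponent left
      over in \<open>ex\<close> cancels, hence the constant 1 in front of the final bound.\<close>
    have cardF: "real (card F) \<le> exp (2 * ?D * (real n * q))"
    proof -
      have "real (card F) \<le> real ((n + 1) ^ (CARD('d) * r))" using F(2) by (simp only: of_nat_le_iff)
      also have "\<dots> = exp (real (CARD('d) * r) * ln (real n + 1))"
        by (simp only: exp_of_nat_mult) (simp add: add.commute)
      also have "\<dots> \<le> exp (2 * ?D * (real n * q))"
      proof -
        have "real n + 1 \<le> (real n)\<^sup>2"
        proof -
          have "2 * real n \<le> real n * real n" using n by (intro mult_right_mono) auto
          then show ?thesis using n unfolding power2_eq_square by linarith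
        qed
        then have "ln (real n + 1) \<le> ln ((real n)\<^sup>2)" using n by (intro ln_mono) auto
        then have ln: "ln (real n + 1) \<le> 2 * ln (real n)" using n by (simp add: ln_realpow)
        have "real r \<le> (real n / ln (real n)) powr ((?D - 1) / (?D + 1))"
          unfolding r(1) num_vertices_def by (simp add: of_nat_nat)
        then have "real r * ln (real n) \<le> real n * q"
          unfolding qa(3)[symmetric] using n by (intro mult_right_mono) auto
        then have "2 * ?D * (real r * ln (real n)) \<le> 2 * ?D * (real n * q)"
          by (intro mult_left_mono) auto
        moreover have "real (CARD('d) * r) * ln (real n + 1) \<le> real (CARD('d) * r) * (2 * ln (real n))"
          using ln by (intro mult_left_mono) auto
        moreover have "real (CARD('d) * r) * (2 * ln (real n)) = 2 * ?D * (real r * ln (real n))" by simp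
        ultimately have "real (CARD('d) * r) * ln (real n + 1) \<le> 2 * ?D * (real n * q)" by linarith
        then show ?thesis by (simp only: exp_le_cancel_iff)
      qed
      finally show ?thesis .
    qed
    have "prob {\<omega> \<in> space (sample_law N n C).
         x \<le> real n * (measure lborel (sym_diff (Phat \<omega>) C)
            - (C3 * ln (real n) / real n) powr (2 / (?D + 1)))} \<le> prob (\<Union>P\<in>F. ?E P)"
      using sub Es F(1) by (intro finite_measure_mono) auto
    also have "\<dots> \<le> (\<Sum>P\<in>F. prob (?E P))"
      using Es F(1) by (intro finite_measure_subadditive_finite) auto
    also have "\<dots> \<le> (\<Sum>P\<in>F. exp (- (2 * ?D * (real n * q)) - \<alpha> * x))"
      using Eb unfolding ex by (intro sum_mono)
    also have "\<dots> = real (card F) * exp (- (2 * ?D * (real n * q)) - \<alpha> * x)" by simp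
    also have "\<dots> \<le> exp (2 * ?D * (real n * q)) * exp (- (2 * ?D * (real n * q)) - \<alpha> * x)"
      using cardF by (intro mult_right_mono) auto
    also have "\<dots> = exp (- \<alpha> * x)" by (simp add: exp_add[symmetric])
    finally show ?thesis .
  qed
  \<comment> \<open>The supremum is the conditional one of the reals, so bounding it by a common
    upper bound takes a nonempty index set.\<close>
  have ne: "(convex_bodies :: (real ^ 'd) set set) \<noteq> {}"
  proof -
    have "(\<chi> i. 1/2) \<in> interior (cbox 0 1 :: (real ^ 'd) set)"
      by (simp add: interior_cbox mem_box_cart)
    then have "cbox 0 1 \<in> (convex_bodies :: (real ^ 'd) set set)"
      unfolding convex_bodies_def by auto
    then show ?thesis by blast
  qed
  show ?thesis
  proof (rule exI[of _ 1], rule conjI[OF zero_less_one], rule exI[of _ \<alpha>], rule conjI[OF \<alpha>],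
      rule exI[of _ C3], rule conjI[OF C3], intro allI impI)
    fix n r :: nat and N :: "real measure" and Phat :: "(nat \<Rightarrow> (real ^ 'd) \<times> real) \<Rightarrow> (real ^ 'd) set"
      and x :: real
    assume "2 \<le> n" "r = num_vertices CARD('d) n" "CARD('d) + 1 \<le> r" "prob_space N"
      "sets N = sets borel" "subgaussian \<sigma> N" "is_estimator r n Phat"
    from main[OF this]
    show "(SUP C\<in>convex_bodies. measure (sample_law N n C)
          {\<omega> \<in> space (sample_law N n C).
             x \<le> real n * (measure lborel (sym_diff (Phat \<omega>) C)
                - (C3 * ln (real n) / real n) powr (2 / (?D + 1)))}) \<le> 1 * exp (- \<alpha> * x)"
      unfolding mult_1_left by (intro cSUP_least ne)
  qed
qed

end
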